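(* Every $2$-connected subcubic outerplanar graph has a $(1,2^4)$-packing edge-coloring, that is, a $(1,2,2,2,2)$-packing edge-coloring.
   Context: Graphs are finite and simple. A graph is subcubic if its maximum degree is at most $3$. The distance between two distinct edges of a graph $G$ is their distance in the line graph of $G$, so edges sharing an endpoint are at distance $1$ (edges in different components are at infinite distance). For a non-decreasing sequence $S=(s_1,\dots,s_k)$ of positive integers, an $S$-packing edge-coloring ($S$-coloring) of $G$ is a partition of $E(G)$ into (possibly empty) classes $E_1,\dots,E_k$ such that for each $i$ any two distinct edges in $E_i$ are at distance at least $s_i+1$. Exponents denote repetition: $(1,2^4)=(1,2,2,2,2)$. Thus a class for an entry $1$ is a matching, and a class for an entry $2$ is an induced matching. *)

theory Defs
  imports "HOL-Analysis.Analysis" "HOL-Library.Extended_Nat"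
begin

text \<open>A graph is given by its vertex set \<open>V\<close> and its set \<open>E\<close> of edges, an edge being the set
  of its two ends.\<close>

definition simple_graph :: "'a set \<Rightarrow> 'a set set \<Rightarrow> bool" where
  "simple_graph V E \<longleftrightarrow> finite V \<and> (\<forall>e\<in>E. e \<subseteq> V \<and> card e = 2)"

definition degree :: "'a set set \<Rightarrow> 'a \<Rightarrow> nat" where
  "degree E v = card {e \<in> E. v \<in> e}"

definition subcubic :: "'a set \<Rightarrow> 'a set set \<Rightarrow> bool" where
  "subcubic V E \<longleftrightarrow> (\<forall>v\<in>V. degree E v \<le> 3)"

definition walks :: "'a set \<Rightarrow> 'a set set \<Rightarrow> 'a \<Rightarrow> 'a \<Rightarrow> 'a list set" where
  "walks V E u v =
     {xs. xs \<noteq> [] \<and> set xs \<subseteq> V \<and> hd xs = u \<and> last xs = v \<and>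
          successively (\<lambda>x y. {x, y} \<in> E) xs}"

text \<open>The infimum over the empty set is \<open>\<infinity>\<close>, so vertices in different components are at
  infinite distance.\<close>

definition graph_dist :: "'a set \<Rightarrow> 'a set set \<Rightarrow> 'a \<Rightarrow> 'a \<Rightarrow> enat" where
  "graph_dist V E u v = (INF xs\<in>walks V E u v. enat (length xs - 1))"

definition graph_connected :: "'a set \<Rightarrow> 'a set set \<Rightarrow> bool" where
  "graph_connected V E \<longleftrightarrow> V \<noteq> {} \<and> (\<forall>u\<in>V. \<forall>v\<in>V. walks V E u v \<noteq> {})"

definition k_connected :: "nat \<Rightarrow> 'a set \<Rightarrow> 'a set set \<Rightarrow> bool" where
  "k_connected k V E \<longleftrightarrow>
     card V > k \<and>
     (\<forall>X\<subseteq>V. card X < k \<longrightarrow> graph_connected (V - X) {e \<in> E. e \<inter> X = {}})"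

text \<open>The line graph of a graph with edge set \<open>E\<close> has vertex set \<open>E\<close> and the following edges.\<close>

definition line_graph_edges :: "'a set set \<Rightarrow> 'a set set set" where
  "line_graph_edges E = {{e, f} | e f. e \<in> E \<and> f \<in> E \<and> e \<noteq> f \<and> e \<inter> f \<noteq> {}}"

definition edge_dist :: "'a set set \<Rightarrow> 'a set \<Rightarrow> 'a set \<Rightarrow> enat" where
  "edge_dist E = graph_dist E (line_graph_edges E)"

text \<open>Here \<open>S\<close> is meant to be a non-decreasing list of positive integers, and \<open>C i\<close> is the
  (possibly empty) class belonging to the entry \<open>S ! i\<close>, indexed from 0.\<close>

definition packing_edge_coloring :: "nat list \<Rightarrow> 'a set set \<Rightarrow> (nat \<Rightarrow> 'a set set) \<Rightarrow> bool" where
  "packing_edge_coloring S E C \<longleftrightarrow>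
     (\<Union>i<length S. C i) = E \<and>
     disjoint_family_on C {..<length S} \<and>
     (\<forall>i<length S. \<forall>e\<in>C i. \<forall>f\<in>C i. e \<noteq> f \<longrightarrow> edge_dist E e f \<ge> enat (S ! i + 1))"

text \<open>Drawings in the plane \<open>\<complex>\<close>: the vertex \<open>v\<close> is drawn as the point \<open>p v\<close> and the edge \<open>e\<close>
  as the (not necessarily polygonal) arc \<open>g e\<close>.\<close>

definition plane_embedding ::
    "'a set \<Rightarrow> 'a set set \<Rightarrow> ('a \<Rightarrow> complex) \<Rightarrow> ('a set \<Rightarrow> real \<Rightarrow> complex) \<Rightarrow> bool" where
  "plane_embedding V E p g \<longleftrightarrow>
     inj_on p V \<and>
     (\<forall>e\<in>E. arc (g e) \<and> {pathstart (g e), pathfinish (g e)} = p ` e \<and>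
            path_image (g e) \<inter> p ` V = p ` e) \<and>
     (\<forall>e\<in>E. \<forall>f\<in>E. e \<noteq> f \<longrightarrow> path_image (g e) \<inter> path_image (g f) = p ` (e \<inter> f))"

definition drawing ::
    "'a set \<Rightarrow> 'a set set \<Rightarrow> ('a \<Rightarrow> complex) \<Rightarrow> ('a set \<Rightarrow> real \<Rightarrow> complex) \<Rightarrow> complex set" where
  "drawing V E p g = p ` V \<union> (\<Union>e\<in>E. path_image (g e))"

text \<open>For a compact set \<open>X\<close> in the plane, \<open>outside X\<close> is the unbounded component of the
  complement of \<open>X\<close>, that is, the outer face of a drawing \<open>X\<close>.\<close>

definition outerplanar :: "'a set \<Rightarrow> 'a set set \<Rightarrow> bool" where
  "outerplanar V E \<longleftrightarrow>
     (\<exists>p g. plane_embedding V E p g \<and> p ` V \<subseteq> frontier (outside (drawing V E p g)))"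

end

theory Submission
  imports Defs "HOL-Complex_Analysis.Winding_Numbers"
begin

text \<open>If three arcs with common ends are otherwise disjoint, one of them runs inside the closed curve
  formed by the other two: the three winding numbers add up to zero. Hence an outerplanar graph has no
  three internally disjoint paths of length at least 2 between two vertices. An ear attached to a
  longest cycle would produce such a theta, so a 2-connected graph without thetas is Hamiltonian, and
  crossing chords of the cycle also produce one unless the graph is $K_4$.

  In a subcubic graph the chords form a matching, which receives the colour of the entry 1. The cycle
  edges are coloured so that edges at distance at most 2 along the cycle differ and the four cycle
  edges at the ends of a chord are all different. Given the four colours at a chord, the path below
  the chord is coloured from left to right by a finite automaton, recursively for the chords that it
  passes; the only path on which this fails has three edges and no chords, and then its middle edge
  can be added to the matching.\<close>

section \<open>Theta curves\<close>

text \<open>The four cycle edges at the ends of a chord are pairwise within distance 2 and meet an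
  edge of the matching, so they use up the colours of the four entries 2. This dictates the
  induction claim: an interval of the path must be colourable for every prescription of four
  different colours at its two ends. Permuting colours makes all prescriptions equivalent, so a
  single one, 1, 3 on the left and 4, 2 on the right, has to be treated, and the two sides of a
  chord can then be glued.

  The automaton forgets its start: from length 5 on it accepts every word from every state, which
  leaves a finite check. On the exceptional path the middle edge is within distance 2 of all four
  prescribed colours; its ends carry no chord, so it is free to join the matching.

  Conditions on cycle edges involve three consecutive edges at most. A cycle is therefore treated as
  a path that repeats its first two edges at the end.\<close>

lemma connected_subset_inside:
  fixes S T :: "complex set"
  assumes "connected S" "S \<inter> T = {}" "closed T" "S \<inter> inside T \<noteq> {}"
  shows "S \<subseteq> inside T"
proof (rule ccontr)
  assume "\<not> S \<subseteq> inside T"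
  moreover have "S \<subseteq> inside T \<union> outside T"
    using assms(2) inside_Un_outside[of T] by blast
  ultimately have "S \<inter> outside T \<noteq> {}" by blast
  moreover have "inside T \<inter> outside T \<inter> S = {}"
    using inside_Int_outside by blast
  ultimately show False
    using connectedD[OF assms(1) open_inside[OF assms(3)] open_outside[OF assms(3)]]
      \<open>S \<subseteq> inside T \<union> outside T\<close> assms(4) by blast
qed

definition arc_between :: "(real \<Rightarrow> complex) \<Rightarrow> complex \<Rightarrow> complex \<Rightarrow> bool" where
  "arc_between c a b \<longleftrightarrow> arc c \<and> pathstart c = a \<and> pathfinish c = b"

lemma simple_path_join_arcs:
  assumes "arc_between c1 a b" "arc_between c2 a b" "path_image c1 \<inter> path_image c2 = {a, b}"
  shows "simple_path (c1 +++ reversepath c2)"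
    and "pathfinish (c1 +++ reversepath c2) = pathstart (c1 +++ reversepath c2)"
    and "path_image (c1 +++ reversepath c2) = path_image c1 \<union> path_image c2"
    and "z \<notin> path_image c1 \<union> path_image c2 \<Longrightarrow>
           winding_number (c1 +++ reversepath c2) z = winding_number c1 z - winding_number c2 z"
proof -
  have c: "arc c1" "arc c2" "pathstart c1 = a" "pathfinish c1 = b" "pathstart c2 = a" "pathfinish c2 = b"
    using assms(1,2) unfolding arc_between_def by simp_all
  show "simple_path (c1 +++ reversepath c2)"
    using c assms(3) by (intro simple_path_join_loop) (simp_all add: arc_reversepath)
  show "pathfinish (c1 +++ reversepath c2) = pathstart (c1 +++ reversepath c2)"
    using c by simp
  show "path_image (c1 +++ reversepath c2) = path_image c1 \<union> path_image c2"
    using c by (simp add: path_image_join)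
  show "winding_number (c1 +++ reversepath c2) z = winding_number c1 z - winding_number c2 z"
    if "z \<notin> path_image c1 \<union> path_image c2"
    using c that by (simp add: arc_imp_path winding_number_join winding_number_reversepath)
qed

text \<open>The winding numbers put \<open>z\<close> inside the second closed curve as well. Each
  inside is connected and avoids the boundary of the other, so the two insides contain each other,
  and a Jordan curve is the frontier of its inside.\<close>

lemma theta_insides_eq:
  assumes "arc_between c1 a b" "arc_between c2 a b" "arc_between c3 a b"
    and "path_image c1 \<inter> path_image c2 = {a, b}" "path_image c1 \<inter> path_image c3 = {a, b}"
    and "path_image c3 \<inter> inside (path_image c1 \<union> path_image c2) = {}"
    and "path_image c2 \<inter> inside (path_image c1 \<union> path_image c3) = {}"
    and z: "z \<in> inside (path_image c1 \<union> path_image c2)"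
    and w: "winding_number c1 z \<noteq> winding_number c3 z"
  shows "path_image c1 \<union> path_image c2 = path_image c1 \<union> path_image c3"
proof -
  note j2 = simple_path_join_arcs[OF assms(1,2,4)]
  note j3 = simple_path_join_arcs[OF assms(1,3,5)]
  note J2 = Jordan_inside_outside[OF j2(1,2), unfolded j2(3)]
  note J3 = Jordan_inside_outside[OF j3(1,2), unfolded j3(3)]
  have "path_image c1 \<inter> inside (path_image c1 \<union> path_image c2) = {}"
    "path_image c1 \<inter> inside (path_image c1 \<union> path_image c3) = {}"
    using inside_no_overlap by blast+
  then have dis: "inside (path_image c1 \<union> path_image c2) \<inter> (path_image c1 \<union> path_image c3) = {}"
    "inside (path_image c1 \<union> path_image c3) \<inter> (path_image c1 \<union> path_image c2) = {}"
    using assms(6,7) by blast+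
  then have "z \<notin> path_image c1 \<union> path_image c3" using z by blast
  then have "winding_number (c1 +++ reversepath c3) z \<noteq> 0" using j3(4) w by simp
  then have "z \<notin> outside (path_image c1 \<union> path_image c3)"
    using winding_number_zero_in_outside[of "c1 +++ reversepath c3" z] j3
    by (auto simp: simple_path_imp_path)
  then have z3: "z \<in> inside (path_image c1 \<union> path_image c3)"
    using \<open>z \<notin> path_image c1 \<union> path_image c3\<close> J3 by blast
  have cl: "closed (path_image c1 \<union> path_image c2)" "closed (path_image c1 \<union> path_image c3)"
    using j2 j3 by (metis closed_simple_path_image)+
  have "inside (path_image c1 \<union> path_image c2) \<subseteq> inside (path_image c1 \<union> path_image c3)"
    by (rule connected_subset_inside[OF _ dis(1) cl(2)]) (use J2 z z3 in auto)
  moreover have "inside (path_image c1 \<union> path_image c3) \<subseteq> inside (path_image c1 \<union> path_image c2)"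
    by (rule connected_subset_inside[OF _ dis(2) cl(1)]) (use J3 z z3 in auto)
  ultimately have "inside (path_image c1 \<union> path_image c2) = inside (path_image c1 \<union> path_image c3)"
    by blast
  moreover have "frontier (inside (path_image c1 \<union> path_image c2)) = path_image c1 \<union> path_image c2"
    "frontier (inside (path_image c1 \<union> path_image c3)) = path_image c1 \<union> path_image c3"
    using J2 J3 by simp_all
  ultimately show ?thesis by metis
qed

text \<open>The marked point on each arc keeps that arc out of the inside of the other two; but then
  two of the three closed curves would coincide.\<close>

lemma theta_not_outer:
  assumes c: "arc_between c1 a b" "arc_between c2 a b" "arc_between c3 a b"
    and i: "path_image c1 \<inter> path_image c2 = {a, b}" "path_image c1 \<inter> path_image c3 = {a, b}"
      "path_image c2 \<inter> path_image c3 = {a, b}"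
    and D: "path_image c1 \<union> path_image c2 \<union> path_image c3 \<subseteq> D"
    and x: "x1 \<in> path_image c1 - {a, b}" "x2 \<in> path_image c2 - {a, b}" "x3 \<in> path_image c3 - {a, b}"
    and f: "{x1, x2, x3} \<subseteq> frontier (outside D)"
  shows False
proof -
  have ab: "a \<noteq> b" using c(1) arc_distinct_ends unfolding arc_between_def by blast
  have out: "path_image e \<inter> inside (path_image c \<union> path_image d) = {}"
    if "arc_between c a b" "arc_between d a b" "arc_between e a b"
      "path_image c \<inter> path_image d = {a, b}" "path_image c \<inter> path_image e = {a, b}"
      "path_image d \<inter> path_image e = {a, b}" "path_image c \<union> path_image d \<subseteq> D"
      "x \<in> path_image e - {a, b}" "x \<in> frontier (outside D)" for c d e x
  proof (rule ccontr)
    let ?I = "inside (path_image c \<union> path_image d)"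
    assume ne: "path_image e \<inter> ?I \<noteq> {}"
    have sp: "simple_path c" "simple_path d" "simple_path e"
      and ends: "pathstart c = a" "pathfinish c = b" "pathstart d = a" "pathfinish d = b"
        "pathstart e = a" "pathfinish e = b"
      using that(1-3) unfolding arc_between_def by (simp_all add: arc_imp_simple_path)
    \<comment> \<open>An arc that enters the inside stays there, since it meets the boundary only at
      its ends. Its point \<open>x\<close> would then lie in an open set disjoint from the outer
      face.\<close>
    have "path_image e - {a, b} \<subseteq> ?I"
      by (rule split_inside_simple_closed_curve[OF sp(1) ends(1,2) sp(2) ends(3,4) sp(3) ends(5,6)
            ab that(4-6) ne]) blast
    then have "x \<in> ?I" using that by blast
    moreover have "open ?I"
      using that by (intro open_inside closed_Un) (auto simp: arc_between_def closed_arc_image)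
    moreover have "?I \<inter> outside D = {}"
      using outside_mono[OF that(7)] inside_Int_outside by blast
    then have "?I \<inter> closure (outside D) = {}"
      using \<open>open ?I\<close> by (simp add: open_Int_closure_eq_empty)
    ultimately show False using that(9) unfolding frontier_def by blast
  qed
  have o: "path_image c3 \<inter> inside (path_image c1 \<union> path_image c2) = {}"
    "path_image c2 \<inter> inside (path_image c1 \<union> path_image c3) = {}"
    "path_image c1 \<inter> inside (path_image c2 \<union> path_image c3) = {}"
    subgoal by (rule out[OF c(1,2,3) i(1,2,3) _ x(3)]) (use D f in auto)
    subgoal by (rule out[OF c(1,3,2) i(2,1) _ _ x(2)]) (use i D f in auto)
    subgoal by (rule out[OF c(2,3,1) i(3) _ _ _ x(1)]) (use i D f in auto)
    done
  note j = simple_path_join_arcs[OF c(1,2) i(1)]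
  obtain z where z: "z \<in> inside (path_image c1 \<union> path_image c2)"
    using Jordan_inside_outside[OF j(1,2)] j(3) by auto
  then have "z \<notin> path_image c1 \<union> path_image c2" using inside_no_overlap by blast
  then have w: "winding_number c1 z \<noteq> winding_number c2 z"
    using j z simple_closed_path_norm_winding_number_inside[OF j(1), of z] by auto
  have "x3 \<notin> path_image c1" "x3 \<notin> path_image c2" using x(3) i by blast+
  moreover have "path_image c1 \<union> path_image c2 = path_image c1 \<union> path_image c3 \<or>
      path_image c2 \<union> path_image c1 = path_image c2 \<union> path_image c3"
  \<comment> \<open>The winding numbers of \<open>c1\<close> and \<open>c2\<close> at
    \<open>z\<close> differ, so that of \<open>c3\<close> differs from at least one of them.\<close>
  proof (cases "winding_number c1 z = winding_number c3 z")
    case False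
    then show ?thesis using theta_insides_eq[OF c(1,2,3) i(1,2) o(1,2) z] by blast
  next
    case True
    then show ?thesis
      using theta_insides_eq[OF c(2,1,3) _ i(3) _ o(3), of z] i(1) o(1) z w
      by (simp only: Un_commute[of "path_image c2" "path_image c1"]
          Int_commute[of "path_image c2" "path_image c1"]) simp
  qed
  ultimately show False using x(3) by blast
qed

section \<open>Outerplanar graphs contain no thetas\<close>

abbreviation walk :: "'a set set \<Rightarrow> 'a list \<Rightarrow> bool" where
  "walk E \<equiv> successively (\<lambda>x y. {x, y} \<in> E)"

fun path_edges :: "'a list \<Rightarrow> 'a set set" where
  "path_edges (x # y # zs) = insert {x, y} (path_edges (y # zs))"
| "path_edges _ = {}"

lemma path_edges_subset: "walk E xs \<Longrightarrow> path_edges xs \<subseteq> E"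
  by (induction xs rule: path_edges.induct) auto

lemma path_edge_subset_set: "e \<in> path_edges xs \<Longrightarrow> e \<subseteq> set xs"
  by (induction xs rule: path_edges.induct) auto

lemma set_subset_path_edges: "length xs \<ge> 2 \<Longrightarrow> set xs \<subseteq> \<Union> (path_edges xs)"
proof (induction xs rule: path_edges.induct)
  case (1 x y zs)
  then show ?case by (cases zs) auto
qed auto

text \<open>Hence internally disjoint paths, one of which has inner vertices, share no edge; this
  keeps their drawings apart.\<close>

lemma path_edge_meets_interior:
  "A \<noteq> [] \<Longrightarrow> e \<in> path_edges (u # A @ [w]) \<Longrightarrow> e \<inter> set A \<noteq> {}"
proof (induction A arbitrary: u)
  case (Cons a A)
  show ?case
  proof (cases A)
    case Nil
    then show ?thesis using Cons.prems by auto
  next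
    case (Cons a' A')
    then show ?thesis using Cons.IH[of a] Cons.prems(2) by auto
  qed
qed simp

text \<open>Distinctness of the vertices makes the arc of the first edge meet the rest only in the
  next vertex, so joining them gives an arc again.\<close>

lemma ex_arc_along_path:
  assumes "plane_embedding V E p g"
  shows "distinct xs \<Longrightarrow> walk E xs \<Longrightarrow> length xs \<ge> 2 \<Longrightarrow>
    \<exists>\<gamma>. arc_between \<gamma> (p (hd xs)) (p (last xs)) \<and>
        path_image \<gamma> = (\<Union>e\<in>path_edges xs. path_image (g e))"
proof (induction xs rule: path_edges.induct)
  case (1 x y zs)
  have e: "{x, y} \<in> E" using "1.prems" by simp
  have "arc (g {x, y})" "{pathstart (g {x, y}), pathfinish (g {x, y})} = {p x, p y}"
    using assms e unfolding plane_embedding_def by auto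
  \<comment> \<open>A drawing gives its edges no prescribed direction, so \<open>g {x, y}\<close>
    may have to be reversed.\<close>
  then have "\<exists>h. arc_between h (p x) (p y) \<and> path_image h = path_image (g {x, y})"
    unfolding arc_between_def
    by (metis arc_reversepath doubleton_eq_iff path_image_reversepath pathfinish_reversepath
        pathstart_reversepath)
  then obtain h where h: "arc_between h (p x) (p y)" "path_image h = path_image (g {x, y})"
    by blast
  show ?case
  proof (cases zs)
    case Nil
    then show ?thesis using h by auto
  next
    case (Cons z zs')
    obtain \<gamma> where \<gamma>: "arc_between \<gamma> (p y) (p (last zs))"
        "path_image \<gamma> = (\<Union>e\<in>path_edges (y # zs). path_image (g e))"
      using "1.IH" "1.prems" Cons by auto
    have "path_image (g {x, y}) \<inter> path_image (g f) \<subseteq> {p y}" if "f \<in> path_edges (y # zs)" for f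
    proof -
      have "f \<subseteq> set (y # zs)" "f \<in> E"
        using that path_edge_subset_set path_edges_subset "1.prems"(2) by (fastforce, force)
      moreover have "x \<notin> f" using calculation "1.prems"(1) by auto
      moreover have "\<forall>e\<in>E. \<forall>f\<in>E. e \<noteq> f \<longrightarrow> path_image (g e) \<inter> path_image (g f) = p ` (e \<inter> f)"
        using assms unfolding plane_embedding_def by simp
      moreover have "{x, y} \<noteq> f" using \<open>x \<notin> f\<close> by blast
      ultimately have "path_image (g {x, y}) \<inter> path_image (g f) = p ` ({x, y} \<inter> f)"
        using e by simp
      then show ?thesis using \<open>x \<notin> f\<close> by auto
    qed
    then have "path_image h \<inter> path_image \<gamma> \<subseteq> {p y}" using h(2) \<gamma>(2) by blast
    then have "arc_between (h +++ \<gamma>) (p x) (p (last zs))"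
      "path_image (h +++ \<gamma>) = path_image h \<union> path_image \<gamma>"
      using h(1) \<gamma>(1) unfolding arc_between_def by (auto simp: arc_join path_image_join)
    then show ?thesis using h(2) \<gamma>(2) Cons by (intro exI[of _ "h +++ \<gamma>"]) auto
  qed
qed auto

text \<open>No two vertices are joined by three internally disjoint paths with at least one inner vertex
  each, i.e. there is no subdivision of $K_{2,3}$.\<close>

definition theta_free :: "'a set set \<Rightarrow> bool" where
  "theta_free E \<longleftrightarrow> (\<nexists>u w A B C. A \<noteq> [] \<and> B \<noteq> [] \<and> C \<noteq> [] \<and> distinct (u # w # A @ B @ C) \<and>
     walk E (u # A @ [w]) \<and> walk E (u # B @ [w]) \<and> walk E (u # C @ [w]))"

text \<open>The first inner vertex of each path supplies the point on the outer frontier that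
  \<open>theta_not_outer\<close> needs on each arc.\<close>

lemma outerplanar_imp_theta_free:
  assumes "simple_graph V E" "outerplanar V E"
  shows "theta_free E"
  unfolding theta_free_def
proof (intro notI, elim exE conjE)
  fix u w A B C
  assume ne: "A \<noteq> []" "B \<noteq> []" "C \<noteq> []" and d: "distinct (u # w # A @ B @ C)"
    and wk: "walk E (u # A @ [w])" "walk E (u # B @ [w])" "walk E (u # C @ [w])"
  obtain p g where emb: "plane_embedding V E p g"
    and out: "p ` V \<subseteq> frontier (outside (drawing V E p g))"
    using assms(2) unfolding outerplanar_def by blast
  have inj: "inj_on p V"
    and pe: "\<And>e. e \<in> E \<Longrightarrow> path_image (g e) \<inter> p ` V = p ` e"
    and pp: "\<And>e f. e \<in> E \<Longrightarrow> f \<in> E \<Longrightarrow> e \<noteq> f \<Longrightarrow>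
      path_image (g e) \<inter> path_image (g f) = p ` (e \<inter> f)"
    using emb unfolding plane_embedding_def by blast+
  have EV: "\<And>e. e \<in> E \<Longrightarrow> e \<subseteq> V" using assms(1) unfolding simple_graph_def by blast
  define I where "I X = (\<Union>e\<in>path_edges (u # X @ [w]). path_image (g e))" for X
  have V: "set (u # X @ [w]) \<subseteq> V" if "walk E (u # X @ [w])" for X
    using set_subset_path_edges[of "u # X @ [w]"] path_edges_subset[OF that] EV by fastforce
  have arcs: "\<exists>c. arc_between c (p u) (p w) \<and> path_image c = I X"
    if "walk E (u # X @ [w])" "distinct (u # X @ [w])" for X
    using ex_arc_along_path[OF emb that(2,1)] unfolding I_def by simp
  have vert: "p x \<in> I X" if wX: "walk E (u # X @ [w])" and x: "x \<in> set (u # X @ [w])" for X x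
  proof -
    obtain e where "e \<in> path_edges (u # X @ [w])" "x \<in> e"
      using set_subset_path_edges[of "u # X @ [w]"] x by fastforce
    then show ?thesis using pe path_edges_subset[OF wX] unfolding I_def by blast
  qed
  have meet: "I X \<inter> I Y = {p u, p w}"
    if "walk E (u # X @ [w])" "walk E (u # Y @ [w])" "X \<noteq> []" "distinct (u # w # X @ Y)" for X Y
  proof
    show "{p u, p w} \<subseteq> I X \<inter> I Y" using vert that(1,2) by simp
    show "I X \<inter> I Y \<subseteq> {p u, p w}"
    proof
      fix z assume "z \<in> I X \<inter> I Y"
      then obtain e f where ef: "e \<in> path_edges (u # X @ [w])" "f \<in> path_edges (u # Y @ [w])"
        "z \<in> path_image (g e)" "z \<in> path_image (g f)" unfolding I_def by blast
      have sub: "e \<subseteq> set (u # X @ [w])" "f \<subseteq> set (u # Y @ [w])"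
        using path_edge_subset_set ef by blast+
      have "e \<inter> set X \<noteq> {}" using path_edge_meets_interior[OF that(3) ef(1)] .
      then have "e \<noteq> f" using sub(2) that(4) by auto
      then have "z \<in> p ` (e \<inter> f)"
        using pp ef path_edges_subset[OF that(1)] path_edges_subset[OF that(2)] by blast
      moreover have "e \<inter> f \<subseteq> {u, w}" using sub that(4) by auto
      ultimately show "z \<in> {p u, p w}" by blast
    qed
  qed
  have pt: "p (hd X) \<in> I X - {p u, p w}" "p (hd X) \<in> frontier (outside (drawing V E p g))"
    if "walk E (u # X @ [w])" "X \<noteq> []" "distinct (u # w # X)" for X
  proof -
    have "hd X \<in> set X" using that(2) by simp
    then have *: "hd X \<in> V" "u \<in> V" "w \<in> V" "hd X \<noteq> u" "hd X \<noteq> w"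
      using V[OF that(1)] that(3) by auto
    then show "p (hd X) \<in> I X - {p u, p w}"
      using vert[OF that(1), of "hd X"] \<open>hd X \<in> set X\<close> inj by (auto simp: inj_on_eq_iff)
    show "p (hd X) \<in> frontier (outside (drawing V E p g))" using *(1) out by blast
  qed
  have sub: "I X \<subseteq> drawing V E p g" if "walk E (u # X @ [w])" for X
    using path_edges_subset[OF that] unfolding I_def drawing_def by blast
  obtain c1 where c1: "arc_between c1 (p u) (p w)" "path_image c1 = I A"
    using arcs[of A] wk(1) d by auto
  obtain c2 where c2: "arc_between c2 (p u) (p w)" "path_image c2 = I B"
    using arcs[of B] wk(2) d by auto
  obtain c3 where c3: "arc_between c3 (p u) (p w)" "path_image c3 = I C"
    using arcs[of C] wk(3) d by auto
  have m: "I A \<inter> I B = {p u, p w}" "I A \<inter> I C = {p u, p w}" "I B \<inter> I C = {p u, p w}"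
    using d by (intro meet wk ne; auto)+
  have D: "I A \<union> I B \<union> I C \<subseteq> drawing V E p g" using sub wk by blast
  have dd: "distinct (u # w # A)" "distinct (u # w # B)" "distinct (u # w # C)" using d by auto
  show False
    using theta_not_outer[OF c1(1) c2(1) c3(1), unfolded c1(2) c2(2) c3(2), OF m D
        pt(1)[OF wk(1) ne(1) dd(1)] pt(1)[OF wk(2) ne(2) dd(2)] pt(1)[OF wk(3) ne(3) dd(3)]]
      pt(2)[OF wk(1) ne(1) dd(1)] pt(2)[OF wk(2) ne(2) dd(2)] pt(2)[OF wk(3) ne(3) dd(3)]
    by blast
qed

section \<open>Hamiltonicity\<close>

lemma ex_successively_leaving:
  assumes "successively P xs" "xs \<noteq> []" "hd xs \<in> S" "last xs \<notin> S"
  shows "\<exists>x y. P x y \<and> x \<in> S \<and> y \<notin> S"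
  using assms
proof (induction xs rule: induct_list012)
  case (3 x y zs)
  show ?case
  proof (cases "y \<in> S")
    case True
    then show ?thesis using "3.IH"(2) "3.prems" by auto
  next
    case False
    then show ?thesis using "3.prems" by auto
  qed
qed auto

lemma walk_rev: "walk E (rev xs) \<longleftrightarrow> walk E xs"
  by (simp add: insert_commute)

text \<open>Take a shortest walk from \<open>x\<close> into \<open>T\<close>: a repeated vertex or
  an earlier visit to \<open>T\<close> would shorten it.\<close>

lemma ex_path_to_set:
  assumes "graph_connected V' E'" "x \<in> V'" "t \<in> V'" "t \<in> T" "x \<notin> T"
  shows "\<exists>Q z. walk E' (x # Q @ [z]) \<and> distinct (x # Q @ [z]) \<and> set (x # Q @ [z]) \<subseteq> V' \<and>
    z \<in> T \<and> set (x # Q) \<inter> T = {}"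
proof -
  define ok where "ok xs \<longleftrightarrow> xs \<noteq> [] \<and> set xs \<subseteq> V' \<and> hd xs = x \<and> last xs \<in> T \<and> walk E' xs" for xs
  obtain zs where "zs \<in> walks V' E' x t"
    using assms(1-3) unfolding graph_connected_def by blast
  then have "\<exists>xs. ok xs" using assms(4) unfolding walks_def ok_def by blast
  then obtain xs where xs: "ok xs" and min: "\<And>ys. ok ys \<Longrightarrow> length xs \<le> length ys"
    using ex_has_least_nat[of ok _ length] by blast
  have early: "u \<notin> T" if "xs = as @ u # bs" "bs \<noteq> []" for as u bs
  proof
    assume "u \<in> T"
    then have "ok (as @ [u])"
      using xs that unfolding ok_def by (auto simp: successively_append_iff hd_append)
    then show False using min[of "as @ [u]"] that by simp
  qed
  have "distinct xs"
  proof (rule ccontr)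
    assume "\<not> distinct xs"
    then obtain as bs cs u where xs_eq: "xs = as @ [u] @ bs @ [u] @ cs"
      using not_distinct_decomp by blast
    then have "ok (as @ [u] @ cs)"
      using xs unfolding ok_def by (auto simp: successively_append_iff successively_Cons hd_append)
    then show False using min[of "as @ [u] @ cs"] xs_eq by simp
  qed
  have "xs = butlast xs @ [last xs]" using xs unfolding ok_def by simp
  moreover have "butlast xs \<noteq> []"
  proof
    assume "butlast xs = []"
    then have "hd xs = last xs" using \<open>xs = butlast xs @ [last xs]\<close> by (metis append_Nil list.sel(1))
    then show False using xs assms(5) unfolding ok_def by simp
  qed
  ultimately obtain Q z where Q: "xs = x # Q @ [z]"
    using xs unfolding ok_def by (metis append_Cons hd_append2 list.exhaust_sel)
  have "set (x # Q) \<inter> T = {}"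
  proof (rule ccontr)
    assume "set (x # Q) \<inter> T \<noteq> {}"
    then obtain u where "u \<in> set (x # Q)" "u \<in> T" by blast
    then obtain as bs where "x # Q = as @ u # bs" by (meson split_list)
    then have "xs = as @ u # (bs @ [z])" using Q by simp
    then show False using early \<open>u \<in> T\<close> by blast
  qed
  then show ?thesis using xs \<open>distinct xs\<close> Q unfolding ok_def by auto
qed

definition cycle :: "'a set set \<Rightarrow> 'a list \<Rightarrow> bool" where
  "cycle E xs \<longleftrightarrow> 2 \<le> length xs \<and> distinct xs \<and> walk E (last xs # xs)"

lemma cycle_rotate: "cycle E (as @ y # bs) \<Longrightarrow> cycle E (y # bs @ as)"
  unfolding cycle_def
  by (cases as rule: rev_cases; cases bs rule: rev_cases)
    (auto simp: successively_append_iff successively_Cons hd_append split: if_splits)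

lemma walk_glue: "walk E (xs @ [z]) \<Longrightarrow> walk E (z # ys) \<Longrightarrow> walk E (xs @ z # ys)"
  by (cases ys) (simp_all add: successively_append_iff)

text \<open>If \<open>y\<close> and \<open>z\<close> are neighbours on the cycle, the ear replaces
  the edge between them. Otherwise \<open>A\<close>, \<open>rev B\<close> and \<open>Q\<close> are
  the inner parts of a theta.\<close>

lemma cycle_extend:
  assumes th: "theta_free E" and c: "cycle E (y # A @ z # B)"
    and Q: "walk E (y # Q @ [z])" "Q \<noteq> []" "distinct Q" "set Q \<inter> set (y # A @ z # B) = {}"
  shows "\<exists>ys. cycle E ys \<and> length (y # A @ z # B) < length ys"
proof (cases "A = [] \<or> B = []")
  case True
  then show ?thesis
  proof
    assume "A = []"
    then have "cycle E (y # Q @ z # B)"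
      using c Q unfolding cycle_def by (auto simp: successively_append_iff successively_Cons split: if_splits)
    then show ?thesis using \<open>A = []\<close> Q(2) by (intro exI[of _ "y # Q @ z # B"]) auto
  next
    assume "B = []"
    obtain q Q' where q: "Q = q # Q'" using Q(2) by (cases Q) auto
    have "walk E (y # A @ [z])" using c \<open>B = []\<close> unfolding cycle_def by simp
    moreover have "walk E (rev (y # Q @ [z]))" using Q(1) unfolding walk_rev .
    then have "walk E (z # rev Q)" using successively_append_iff[of _ "z # rev Q" "[y]"] by simp
    ultimately have "walk E ((y # A) @ z # rev Q)" using walk_glue[of E "y # A" z "rev Q"] by simp
    moreover have "{q, y} \<in> E" using Q(1) q by (simp add: insert_commute)
    ultimately have "cycle E (y # A @ z # rev Q)"
      using c Q(3,4) \<open>B = []\<close> q unfolding cycle_def by auto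
    then show ?thesis using \<open>B = []\<close> Q(2) by (intro exI[of _ "y # A @ z # rev Q"]) auto
  qed
next
  case False
  have w: "walk E (y # A @ [z])" "walk E (z # B @ [y])"
    using c False unfolding cycle_def
    by (auto simp: successively_append_iff successively_Cons split: if_splits)
  have "walk E (y # rev B @ [z])" using walk_rev[of E "z # B @ [y]"] w(2) by simp
  moreover have "distinct (y # z # A @ rev B @ Q)" using c Q unfolding cycle_def by auto
  ultimately have False using th w(1) Q(1,2) False unfolding theta_free_def by blast
  then show ?thesis ..
qed

lemma ex_hamiltonian_cycle:
  assumes g: "simple_graph V E" and k: "k_connected 2 V E" and th: "theta_free E"
  shows "\<exists>xs. cycle E xs \<and> set xs = V"
proof -
  have fin: "finite V" and EV: "\<And>e. e \<in> E \<Longrightarrow> e \<subseteq> V \<and> card e = 2"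
    using g unfolding simple_graph_def by auto
  have cV: "card V > 2" and conn: "\<And>X. X \<subseteq> V \<Longrightarrow> card X < 2 \<Longrightarrow> graph_connected (V - X) {e \<in> E. e \<inter> X = {}}"
    using k unfolding k_connected_def by auto
  have conn0: "graph_connected V E" using conn[of "{}"] by simp
  have leave: "\<exists>x y. {x, y} \<in> E \<and> x \<in> S \<and> y \<notin> S" if S: "S \<subseteq> V" "S \<noteq> {}" "S \<noteq> V" for S
  proof -
    obtain s t where "s \<in> S" "t \<in> V" "t \<notin> S" using S by blast
    moreover obtain xs where "xs \<in> walks V E s t"
      using calculation conn0 S(1) unfolding graph_connected_def by blast
    ultimately show ?thesis
      using ex_successively_leaving[of "\<lambda>x y. {x, y} \<in> E" xs S] unfolding walks_def by auto
  qed
  have cycV: "set xs \<subseteq> V" if "cycle E xs" for xs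
  proof -
    have "set (last xs # xs) \<subseteq> \<Union> (path_edges (last xs # xs))"
      using that unfolding cycle_def by (intro set_subset_path_edges) auto
    then show ?thesis using path_edges_subset[of E "last xs # xs"] that EV unfolding cycle_def by fastforce
  qed
  obtain v where v: "v \<in> V" using cV by fastforce
  have "{v} \<noteq> V" using cV by auto
  then obtain x y where xy: "{x, y} \<in> E" using leave[of "{v}"] v by auto
  then have "x \<noteq> y" using EV[OF xy] by auto
  then have "cycle E [x, y]" using xy unfolding cycle_def by (auto simp: insert_commute)
  moreover have "length xs \<le> card V" if "cycle E xs" for xs
    using card_mono[OF fin cycV[OF that]] that unfolding cycle_def by (simp add: distinct_card)
  ultimately obtain xs where xs: "cycle E xs" and max: "\<And>ys. cycle E ys \<Longrightarrow> length ys \<le> length xs"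
    using ex_has_greatest_nat[of "cycle E" "[x, y]" length "Suc (card V)"]
    by (metis less_Suc_eq_le)
  have "set xs = V"
  proof (rule ccontr)
    assume "set xs \<noteq> V"
    moreover have "set xs \<noteq> {}" using xs unfolding cycle_def by auto
    ultimately obtain y x where yx: "{y, x} \<in> E" "y \<in> set xs" "x \<notin> set xs"
      using leave cycV[OF xs] by blast
    obtain t where t: "t \<in> set xs" "t \<noteq> y"
    proof -
      have "card (set xs) \<noteq> card {y}" using xs unfolding cycle_def by (simp add: distinct_card)
      then have "set xs \<noteq> {y}" by auto
      then show ?thesis using that yx(2) by blast
    qed
    have "y \<in> V" "x \<in> V" using yx EV by auto
    \<comment> \<open>This is where 2-connectedness enters: after deleting \<open>y\<close>, the ear
      that begins with the edge \<open>yx\<close> can still return to the cycle, and does so at a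
      vertex \<open>z\<close> other than \<open>y\<close>.\<close>
    then have "graph_connected (V - {y}) {e \<in> E. e \<inter> {y} = {}}" using conn[of "{y}"] by simp
    then have "\<exists>Q z. walk {e \<in> E. e \<inter> {y} = {}} (x # Q @ [z]) \<and> distinct (x # Q @ [z]) \<and>
        set (x # Q @ [z]) \<subseteq> V - {y} \<and> z \<in> set xs \<and> set (x # Q) \<inter> set xs = {}"
      by (rule ex_path_to_set[where t = t]) (use \<open>x \<in> V\<close> yx t cycV[OF xs] in auto)
    then obtain Q z where Q: "walk {e \<in> E. e \<inter> {y} = {}} (x # Q @ [z])" "distinct (x # Q @ [z])"
        "set (x # Q @ [z]) \<subseteq> V - {y}" "z \<in> set xs" "set (x # Q) \<inter> set xs = {}"
      by blast
    obtain as bs where "xs = as @ y # bs" using yx(2) by (meson split_list)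
    moreover have "z \<noteq> y" using Q(3) by auto
    ultimately have cy: "cycle E (y # bs @ as)" "z \<in> set (bs @ as)" "set (y # bs @ as) = set xs"
        "length (y # bs @ as) = length xs"
      using cycle_rotate xs Q(4) by auto
    obtain A B where AB: "bs @ as = A @ z # B" using cy(2) by (meson split_list)
    have "walk E (x # Q @ [z])" using Q(1) by (rule successively_mono) auto
    then have "walk E (y # (x # Q) @ [z])" using yx(1) by (simp add: successively_Cons)
    then show False
      using cycle_extend[OF th, of y A z B "x # Q"] cy Q(2,5) max unfolding AB by fastforce
  qed
  then show ?thesis using xs by blast
qed

section \<open>Colouring a path with noncrossing chords\<close>

text \<open>The state \<open>(l, x)\<close> holds the colours of the last two edges of a path that is coloured from left
  to right with the colours 1 to 4. A letter \<open>False\<close> is a vertex without a chord. A letter \<open>True\<close> is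
  a chord together with everything below it: the path enters it by \<open>x\<close> and leaves it by \<open>y\<close>, and
  \<open>p\<close>, \<open>q\<close> are the first and the last edge below the chord. The final condition is what a chord
  whose ends carry the colours 1, 3 and 4, 2 requires of the path below it.\<close>

fun accepts :: "bool list \<Rightarrow> nat \<times> nat \<Rightarrow> bool" where
  "accepts [] (l, x) \<longleftrightarrow> l \<noteq> 2 \<and> x = 4"
| "accepts (False # w) (l, x) \<longleftrightarrow> (\<exists>y\<in>set [1, 2, 3, 4]. y \<noteq> l \<and> y \<noteq> x \<and> accepts w (x, y))"
| "accepts (True # w) (l, x) \<longleftrightarrow>
     (\<exists>y\<in>set [1, 2, 3, 4]. \<exists>p\<in>set [1, 2, 3, 4]. \<exists>q\<in>set [1, 2, 3, 4].
        distinct [x, p, q, y] \<and> p \<noteq> l \<and> accepts w (q, y))"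

definition states :: "(nat \<times> nat) list" where
  "states = filter (\<lambda>(l, x). l \<noteq> x) (List.product [1, 2, 3, 4] [1, 2, 3, 4])"

text \<open>The exception arises because the edge between the two plain vertices would have to avoid
  1 and 3 before it, 4 after it, and the final 2.\<close>

lemma accepts_short_words:
  "list_all (\<lambda>n. list_all (\<lambda>w. w = [False, False] \<or> accepts w (1, 3)) (List.n_lists n [False, True]))
     [1, 2, 3, 4]"
  by code_simp

text \<open>Base of the induction on the length. Length 4 would not do:
  \<open>[False, False, False, False]\<close> is rejected from \<open>(4, 2)\<close>.\<close>

lemma accepts_words_of_length_five:
  "list_all (\<lambda>w. list_all (accepts w) states) (List.n_lists 5 [False, True])"
  by code_simp

text \<open>Every letter can be read in every state and leads to a state again, so acceptance from
  all states survives a letter put in front.\<close>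

lemma accepts_ConsI:
  assumes "s \<in> set states" "\<And>s. s \<in> set states \<Longrightarrow> accepts w s"
  shows "accepts (t # w) s"
proof -
  have *: "\<forall>(l, x)\<in>set states.
    (\<exists>y\<in>set [1, 2, 3, 4]. y \<noteq> l \<and> y \<noteq> x \<and> (x, y) \<in> set states) \<and>
    (\<exists>y\<in>set [1, 2, 3, 4]. \<exists>p\<in>set [1, 2, 3, 4]. \<exists>q\<in>set [1, 2, 3, 4].
      distinct [x, p, q, y] \<and> p \<noteq> l \<and> (q, y) \<in> set states)"
    by code_simp
  obtain l x where s: "s = (l, x)" by fastforce
  show ?thesis
  proof (cases t)
    case True
    obtain y p q where y: "y \<in> set [1, 2, 3, 4]" "p \<in> set [1, 2, 3, 4]" "q \<in> set [1, 2, 3, 4]"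
      "distinct [x, p, q, y]" "p \<noteq> l" "(q, y) \<in> set states"
      using bspec[OF * assms(1)] unfolding s by blast
    then have "accepts w (q, y)" using assms(2) by simp
    moreover have "t = True" using True by simp
    ultimately show ?thesis using y by (simp only: s accepts.simps) blast
  next
    case False
    obtain y where y: "y \<in> set [1, 2, 3, 4]" "y \<noteq> l" "y \<noteq> x" "(x, y) \<in> set states"
      using bspec[OF * assms(1)] unfolding s by blast
    then have "accepts w (x, y)" using assms(2) by simp
    moreover have "t = False" using False by simp
    ultimately show ?thesis using y by (simp only: s accepts.simps) blast
  qed
qed

lemma accepts_long_words: "length w \<ge> 5 \<Longrightarrow> s \<in> set states \<Longrightarrow> accepts w s"
proof (induction w arbitrary: s)
  case (Cons t w)
  show ?case
  proof (cases "length w = 4")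
    case True
    then have "t # w \<in> set (List.n_lists 5 [False, True])" by (auto simp: set_n_lists)
    then show ?thesis using accepts_words_of_length_five Cons.prems(2) unfolding list_all_iff by blast
  next
    case False
    then show ?thesis using Cons by (intro accepts_ConsI) auto
  qed
qed simp

lemma accepts_from_1_3:
  assumes "w \<noteq> []" "w \<noteq> [False, False]"
  shows "accepts w (1, 3)"
proof (cases "length w \<ge> 5")
  case True
  moreover have "(1, 3) \<in> set states" by code_simp
  ultimately show ?thesis by (rule accepts_long_words)
next
  case False
  moreover have "length w \<noteq> 0" using assms(1) by simp
  ultimately have "length w = 1 \<or> length w = 2 \<or> length w = 3 \<or> length w = 4" by linarith
  then have "length w \<in> set [1, 2, 3, 4]" by auto
  moreover have "w \<in> set (List.n_lists (length w) [False, True])" by (auto simp: set_n_lists)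
  ultimately show ?thesis using accepts_short_words assms(2) unfolding list_all_iff by blast
qed

lemma set_colours: "set [1, 2, 3, 4] = {1..4::nat}"
  by auto

text \<open>The numbers are positions along the cycle cut open to a path. Since they start at 1, the
  end \<open>a\<close> of a chord lies between the edges \<open>a - 1\<close> and \<open>a\<close>
  without truncated subtraction.\<close>

locale noncrossing_chords =
  fixes ch :: "nat \<Rightarrow> nat \<Rightarrow> bool"
  assumes chord_span: "ch a b \<Longrightarrow> 1 \<le> a \<and> a + 2 \<le> b"
    and chord_unique: "ch a b \<Longrightarrow> ch a' b' \<Longrightarrow> {a, b} \<inter> {a', b'} \<noteq> {} \<Longrightarrow> a = a' \<and> b = b'"
    and noncrossing: "ch a b \<Longrightarrow> ch a' b' \<Longrightarrow> a < a' \<Longrightarrow> a' < b \<Longrightarrow> b' < b"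
begin

text \<open>Edge \<open>i\<close> of the path joins the vertices \<open>i\<close> and \<open>i + 1\<close>. Colour 0 stands for the matching and
  is also the colour of the chords.\<close>

definition proper :: "(nat \<Rightarrow> nat) \<Rightarrow> nat \<Rightarrow> nat \<Rightarrow> bool" where
  "proper c s t \<longleftrightarrow>
     (\<forall>i. s \<le> i \<and> i \<le> t \<longrightarrow> c i \<le> 4) \<and>
     (\<forall>i. s \<le> i \<and> i + 1 \<le> t \<longrightarrow> c i \<noteq> c (i + 1)) \<and>
     (\<forall>i. s \<le> i \<and> i + 2 \<le> t \<longrightarrow> c i = c (i + 2) \<longrightarrow> c i = 0) \<and>
     (\<forall>a b. ch a b \<and> s + 2 \<le> a \<and> b \<le> t \<longrightarrow> distinct [0, c (a - 1), c a, c (b - 1), c b])"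

lemma proper_chord:
  "proper c s t \<Longrightarrow> ch a b \<Longrightarrow> s + 2 \<le> a \<Longrightarrow> b \<le> t \<Longrightarrow> distinct [0, c (a - 1), c a, c (b - 1), c b]"
  unfolding proper_def by blast

text \<open>This lets the path between \<open>a\<close> and \<open>b\<close> be coloured on its own.
  It holds below a chord, but also for the part of the cycle on the other side of a chord, where
  \<open>ab\<close> itself is no chord of \<open>ch\<close>.\<close>

definition closed_interval :: "nat \<Rightarrow> nat \<Rightarrow> bool" where
  "closed_interval a b \<longleftrightarrow>
     (\<forall>x y. ch x y \<and> (a < x \<and> x < b \<or> a < y \<and> y < b) \<longrightarrow> a < x \<and> y < b)"

text \<open>Here \<open>s\<close> and \<open>t\<close> are edges, so the vertices that are decomposed are \<open>s + 2, \<dots>, t\<close>.\<close>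

inductive decomp :: "nat \<Rightarrow> nat \<Rightarrow> bool list \<Rightarrow> bool" where
  Nil: "decomp s (s + 1) []"
| Plain: "(\<And>y. \<not> ch (s + 2) y) \<Longrightarrow> decomp (s + 1) t w \<Longrightarrow> decomp s t (False # w)"
| Chord: "ch (s + 2) b \<Longrightarrow> decomp (b - 1) t w \<Longrightarrow> decomp s t (True # w)"

section \<open>Reading an interval as a word\<close>

lemma decomp_less: "decomp s t w \<Longrightarrow> s < t"
  by (induction rule: decomp.induct) (auto dest: chord_span)

lemma closed_interval_chord: "ch a b \<Longrightarrow> closed_interval a b"
  unfolding closed_interval_def
proof (intro allI impI)
  fix x y assume ab: "ch a b" and *: "ch x y \<and> (a < x \<and> x < b \<or> a < y \<and> y < b)"
  then have "x < y" using chord_span[of x y] by auto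
  have "x \<noteq> a" "y \<noteq> b" using chord_unique[OF ab, of x y] * by auto
  moreover have "\<not> (x < a \<and> a < y \<and> y < b)" using noncrossing[of x y a b] ab * by auto
  moreover have "a < x \<Longrightarrow> x < b \<Longrightarrow> y < b" using noncrossing[OF ab, of x y] * by auto
  ultimately show "a < x \<and> y < b" using * \<open>x < y\<close> by linarith
qed

text \<open>The vertices are read from the left. No chord ends at \<open>s + 2\<close>, as it would
  start outside. If one begins there, noncrossing makes the part behind its end \<open>b\<close> a
  closed interval again, and reading resumes with \<open>b - 1\<close> and \<open>b\<close> as the
  last two edges.\<close>

lemma ex_decomp:
  assumes "s < t" "closed_interval (s + 1) (t + 1)"
  shows "\<exists>w. decomp s t w"
  using assms
proof (induction "t - s" arbitrary: s rule: less_induct)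
  case less
  have cl: "s + 1 < x \<and> y < t + 1" if "ch x y" "s + 1 < x \<and> x < t + 1 \<or> s + 1 < y \<and> y < t + 1" for x y
    using less.prems(2) that unfolding closed_interval_def by blast
  show ?case
  proof (cases "t = s + 1")
    case True
    then show ?thesis using decomp.Nil by blast
  next
    case False
    then have st: "s + 2 \<le> t" using less.prems(1) by simp
    show ?thesis
    proof (cases "\<exists>b. ch (s + 2) b")
      case False
      have "closed_interval (s + 2) (t + 1)"
        unfolding closed_interval_def
      proof (intro allI impI)
        fix x y assume *: "ch x y \<and> (s + 2 < x \<and> x < t + 1 \<or> s + 2 < y \<and> y < t + 1)"
        then have "s + 1 < x \<and> y < t + 1" using cl[of x y] by auto
        moreover have "x \<noteq> s + 2" using False * by blast
        ultimately show "s + 2 < x \<and> y < t + 1" by auto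
      qed
      then have "closed_interval (s + 1 + 1) (t + 1)" by (simp add: add.assoc)
      moreover have "t - (s + 1) < t - s" "s + 1 < t" using st by auto
      ultimately obtain w where "decomp (s + 1) t w" using less.hyps[of "s + 1"] by blast
      then show ?thesis using decomp.Plain False by blast
    next
      case True
      then obtain b where b: "ch (s + 2) b" by blast
      have bt: "s + 4 \<le> b" "b \<le> t" using cl[OF b] st chord_span[OF b] by auto
      have "closed_interval b (t + 1)"
        unfolding closed_interval_def
      proof (intro allI impI)
        fix x y assume *: "ch x y \<and> (b < x \<and> x < t + 1 \<or> b < y \<and> y < t + 1)"
        then have xy: "s + 1 < x" "y < t + 1" using cl[of x y] bt by auto
        have "b < y" using * chord_span[of x y] by auto
        then have "x \<noteq> s + 2" "x \<noteq> b"
          using chord_unique[OF b, of x y] * bt by auto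
        moreover have "\<not> (s + 2 < x \<and> x < b)"
          using noncrossing[OF b, of x y] * \<open>b < y\<close> by auto
        ultimately show "b < x \<and> y < t + 1" using xy by auto
      qed
      moreover have "b - 1 < t" "t - (b - 1) < t - s" "b - 1 + 1 = b" using bt by auto
      ultimately obtain w where "decomp (b - 1) t w" using less.hyps[of "b - 1"] by auto
      then show ?thesis using decomp.Chord b by blast
    qed
  qed
qed

text \<open>The distinct prescribed colours are the condition of the chord \<open>ab\<close> itself,
  which \<open>proper c (a - 1) b\<close> leaves out, as it covers only chords beginning after
  \<open>a\<close>. All choices of colours are demanded, so that any colouring around the chord can
  be continued below it.\<close>

definition extendable :: "nat \<Rightarrow> nat \<Rightarrow> bool" where
  "extendable a b \<longleftrightarrow>
     (\<forall>h p q k. distinct [h, p, q, k] \<longrightarrow> set [h, p, q, k] \<subseteq> {1..4} \<longrightarrow>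
        (\<exists>c. proper c (a - 1) b \<and> c (a - 1) = h \<and> c a = p \<and> c (b - 1) = q \<and> c b = k))"

lemma extendableD:
  "extendable a b \<Longrightarrow> distinct [h, p, q, k] \<Longrightarrow> set [h, p, q, k] \<subseteq> {1..4} \<Longrightarrow>
    \<exists>c. proper c (a - 1) b \<and> c (a - 1) = h \<and> c a = p \<and> c (b - 1) = q \<and> c b = k"
  unfolding extendable_def by blast

text \<open>An accepting run is turned into a colouring: a plain letter puts one edge in front, a
  chord letter has the part below its chord filled in by \<open>extendable\<close>.\<close>

lemma ex_coloring_decomp:
  assumes "decomp s t w" "accepts w (l, x)" "l \<noteq> x" "l \<in> {1..4}" "x \<in> {1..4}"
    and "\<And>a b. ch a b \<Longrightarrow> s + 2 \<le> a \<Longrightarrow> b \<le> t \<Longrightarrow> extendable a b"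
  shows "\<exists>c. proper c s t \<and> c s = l \<and> c (s + 1) = x \<and> c (t - 1) \<noteq> 2 \<and> c t = 4"
  using assms
proof (induction arbitrary: l x rule: decomp.induct)
  case (Nil s)
  then show ?case
    by (intro exI[of _ "\<lambda>i. if i \<le> s then l else x"]) (auto simp: proper_def dest: chord_span)
next
  case (Plain s t w)
  obtain y where y: "y \<in> {1..4}" "y \<noteq> l" "y \<noteq> x" "accepts w (x, y)"
    using Plain.prems(1) unfolding accepts.simps set_colours by blast
  have "\<And>a b. ch a b \<Longrightarrow> s + 1 + 2 \<le> a \<Longrightarrow> b \<le> t \<Longrightarrow> extendable a b"
    using Plain.prems(5) by simp
  then obtain c where c: "proper c (s + 1) t" "c (s + 1) = x" "c (s + 2) = y" "c (t - 1) \<noteq> 2" "c t = 4"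
    using Plain.IH[OF y(4) y(3)[symmetric] Plain.prems(4) y(1)] by auto
  have st: "s + 1 < t" using decomp_less[OF Plain.hyps(2)] .
  let ?c = "c(s := l)"
  have "proper ?c s t"
    unfolding proper_def
  proof (intro conjI allI impI; (elim conjE)?)
    fix i assume i: "s \<le> i" "i \<le> t"
    show "?c i \<le> 4" using c(1) i Plain.prems(3) unfolding proper_def by (cases "i = s") auto
  next
    fix i assume i: "s \<le> i" "i + 1 \<le> t"
    show "?c i \<noteq> ?c (i + 1)"
      using c(1,2) i Plain.prems(2) unfolding proper_def by (cases "i = s") auto
  next
    fix i assume i: "s \<le> i" "i + 2 \<le> t" "?c i = ?c (i + 2)"
    show "?c i = 0" using c(1,3) i y(2) unfolding proper_def by (cases "i = s") auto
  next
    fix a b assume ab: "ch a b" "s + 2 \<le> a" "b \<le> t"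
    then have "a \<noteq> s + 2" using Plain.hyps(1) by blast
    then have *: "s + 1 + 2 \<le> a" "a + 2 \<le> b" using ab chord_span[OF ab(1)] by auto
    then have "distinct [0, c (a - 1), c a, c (b - 1), c b]"
      using proper_chord[OF c(1) ab(1)] ab(3) by blast
    moreover have "a - 1 \<noteq> s" "a \<noteq> s" "b - 1 \<noteq> s" "b \<noteq> s" using * by auto
    ultimately show "distinct [0, ?c (a - 1), ?c a, ?c (b - 1), ?c b]" by simp
  qed
  moreover have "?c (t - 1) \<noteq> 2" "?c t = 4" "?c s = l" "?c (s + 1) = x" using c st by auto
  ultimately show ?case by blast
next
  case (Chord s b t w)
  have sb: "s + 4 \<le> b" using chord_span[OF Chord.hyps(1)] by simp
  have bt: "b \<le> t" using decomp_less[OF Chord.hyps(2)] sb by simp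
  obtain y p q where ypq: "y \<in> {1..4}" "p \<in> {1..4}" "q \<in> {1..4}" "distinct [x, p, q, y]" "p \<noteq> l"
      "accepts w (q, y)"
    using Chord.prems(1) unfolding accepts.simps set_colours by blast
  have "extendable (s + 2) b" using Chord.prems(5) Chord.hyps(1) bt by simp
  then obtain c1 where c1: "proper c1 (s + 1) b" "c1 (s + 1) = x" "c1 (s + 2) = p" "c1 (b - 1) = q" "c1 b = y"
    using extendableD[of "s + 2" b x p q y] ypq(1-4) Chord.prems(4) by auto
  have "\<And>a b'. ch a b' \<Longrightarrow> b - 1 + 2 \<le> a \<Longrightarrow> b' \<le> t \<Longrightarrow> extendable a b'"
    using Chord.prems(5) sb by simp
  then obtain c2 where c2: "proper c2 (b - 1) t" "c2 (b - 1) = q" "c2 b = y" "c2 (t - 1) \<noteq> 2" "c2 t = 4"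
    using Chord.IH[OF ypq(6) _ ypq(3,1)] ypq(4) sb by auto
  \<comment> \<open>\<open>c1\<close> and \<open>c2\<close> agree on the edges \<open>b - 1\<close>
    and \<open>b\<close>. Any three consecutive edges that do not start at \<open>s\<close>
    therefore lie within the range of one of them; at \<open>s\<close> the conditions
    \<open>l \<noteq> x\<close> and \<open>p \<noteq> l\<close> take over.\<close>
  define c where "c i = (if i = s then l else if i \<le> b then c1 i else c2 i)" for i
  have e1: "c i = c1 i" if "s < i" "i \<le> b" for i using that by (simp add: c_def)
  have e2: "c i = c2 i" if "b - 1 \<le> i" for i
    using that sb c1 c2 by (cases "i = b - 1"; cases "i = b") (auto simp: c_def)
  have "proper c s t"
    unfolding proper_def
  proof (intro conjI allI impI; (elim conjE)?)
    fix i assume i: "s \<le> i" "i \<le> t"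
    show "c i \<le> 4"
      using c1(1) c2(1) i Chord.prems(3) unfolding proper_def c_def by auto
  next
    fix i assume i: "s \<le> i" "i + 1 \<le> t"
    consider "i = s" | "s < i" "i + 1 \<le> b" | "b - 1 \<le> i" using i by linarith
    then show "c i \<noteq> c (i + 1)"
    proof cases
      case 1
      then show ?thesis using c1(2) Chord.prems(2) sb by (simp add: c_def)
    next
      case 2
      then show ?thesis using c1(1) e1 unfolding proper_def by auto
    next
      case 3
      then show ?thesis using c2(1) e2 i unfolding proper_def by auto
    qed
  next
    fix i assume i: "s \<le> i" "i + 2 \<le> t" "c i = c (i + 2)"
    consider "i = s" | "s < i" "i + 2 \<le> b" | "b - 1 \<le> i" using i by linarith
    then show "c i = 0"
    proof cases
      case 1
      then show ?thesis using c1(3) ypq(5) sb i(3) by (simp add: c_def)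
    next
      case 2
      then show ?thesis using c1(1) e1 i(3) unfolding proper_def by auto
    next
      case 3
      then show ?thesis using c2(1) e2 i unfolding proper_def by auto
    qed
  next
    fix a b' assume ab: "ch a b'" "s + 2 \<le> a" "b' \<le> t"
    consider "a = s + 2" | "s + 2 < a" "a < b" | "a = b" | "b < a" using ab by linarith
    then show "distinct [0, c (a - 1), c a, c (b' - 1), c b']"
    proof cases
      case 1
      then have "b' = b" using chord_unique[OF Chord.hyps(1) ab(1)] by auto
      then show ?thesis using 1 c1 sb ypq(1-4) Chord.prems(4) by (auto simp: e1)
    next
      case 2
      then have "b' < b" using closed_interval_chord[OF Chord.hyps(1)] ab unfolding closed_interval_def by blast
      moreover have "a + 2 \<le> b'" using chord_span[OF ab(1)] by simp
      ultimately have "c (a - 1) = c1 (a - 1)" "c a = c1 a" "c (b' - 1) = c1 (b' - 1)" "c b' = c1 b'"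
        using 2 by (auto intro!: e1)
      then show ?thesis using proper_chord[OF c1(1) ab(1)] 2(1) \<open>b' < b\<close> by simp
    next
      case 3
      then show ?thesis using chord_unique[OF Chord.hyps(1) ab(1)] sb by auto
    next
      case 4
      moreover have "a + 2 \<le> b'" using chord_span[OF ab(1)] by simp
      ultimately have "c (a - 1) = c2 (a - 1)" "c a = c2 a" "c (b' - 1) = c2 (b' - 1)" "c b' = c2 b'"
        by (auto intro!: e2)
      then show ?thesis using proper_chord[OF c2(1) ab(1)] 4 ab(3) sb by simp
    qed
  qed
  moreover have "c (t - 1) \<noteq> 2" "c t = 4" using e2[of "t - 1"] e2[of t] c2(4,5) bt by simp_all
  moreover have "c s = l" "c (s + 1) = x" using c1(2) sb by (simp_all add: c_def)
  ultimately show ?case by blast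
qed

text \<open>It suffices to treat the prescription 1, 3, 4, 2. The automaton colours the edges up to
  \<open>b - 1\<close>, ending with 4; edge \<open>b\<close> then takes 2, which is why the last but
  one colour of the run must not be 2.\<close>

lemma extendable_closed_interval:
  assumes "1 \<le> a" "a + 2 \<le> b" "closed_interval a b"
  shows "extendable a b"
  using assms
proof (induction "b - a" arbitrary: a b rule: less_induct)
  case less
  have no_end: "\<not> ch x b" if "a < x" for x
    using less.prems(3) that chord_span[of x b] unfolding closed_interval_def by fastforce
  have "\<exists>w. decomp (a - 1) (b - 1) w"
    using less.prems by (intro ex_decomp) auto
  then obtain w where w: "decomp (a - 1) (b - 1) w" by blast
  have IH: "extendable x y" if "ch x y" "a - 1 + 2 \<le> x" "y \<le> b - 1" for x y
  proof -
    have "y - x < b - a" "1 \<le> x" "x + 2 \<le> y" using that chord_span[OF that(1)] by auto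
    then show ?thesis using less.hyps closed_interval_chord[OF that(1)] by blast
  qed
  have "\<exists>c. proper c (a - 1) b \<and> c (a - 1) = 1 \<and> c a = 3 \<and> c (b - 1) = 4 \<and> c b = 2"
  proof (cases "w = [False, False]")
    case True \<comment> \<open>the word the automaton rejects: here the middle edge joins the matching\<close>
    have "b = a + 3"
      using w less.prems(1,2) unfolding True
      by (auto elim!: decomp.cases[of _ _ "_ # _"] decomp.cases[of _ _ "[]"])
    define c :: "nat \<Rightarrow> nat" where
      "c i = (if i < a then 1 else if i = a then 3 else if i = a + 1 then 0 else if i = a + 2 then 4 else 2)" for i
    have "proper c (a - 1) b"
      unfolding proper_def
    proof (intro conjI allI impI; (elim conjE)?)
      fix i show "c i \<le> 4" by (simp add: c_def)
    next
      fix i assume "a - 1 \<le> i" "i + 1 \<le> b"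
      then show "c i \<noteq> c (i + 1)" using \<open>b = a + 3\<close> less.prems(1) by (auto simp: c_def)
    next
      fix i assume "a - 1 \<le> i" "i + 2 \<le> b" "c i = c (i + 2)"
      then show "c i = 0" using \<open>b = a + 3\<close> less.prems(1) by (auto simp: c_def split: if_splits)
    next
      fix x y assume xy: "ch x y" "a - 1 + 2 \<le> x" "y \<le> b"
      \<comment> \<open>With only two vertices strictly between \<open>a\<close> and
        \<open>b\<close>, a chord starting after \<open>a\<close> would have to reach
        \<open>b\<close>, which closedness forbids.\<close>
      then have "y = b" using \<open>b = a + 3\<close> chord_span[OF xy(1)] by simp
      then show "distinct [0, c (x - 1), c x, c (y - 1), c y]" using no_end[of x] xy by simp
    qed
    moreover have "c (a - 1) = 1" "c a = 3" "c (b - 1) = 4" "c b = 2"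
      using \<open>b = a + 3\<close> less.prems(1) by (simp_all add: c_def)
    ultimately show ?thesis by blast
  next
    case False
    have "w \<noteq> []" using w less.prems(1,2) by (auto elim: decomp.cases)
    then have "accepts w (1, 3)" using False accepts_from_1_3 by blast
    then obtain c where c: "proper c (a - 1) (b - 1)" "c (a - 1) = 1" "c a = 3"
        "c (b - 1 - 1) \<noteq> 2" "c (b - 1) = 4"
      using ex_coloring_decomp[OF w, of 1 3] IH less.prems(1) by auto
    \<comment> \<open>Colouring edge \<open>b\<close> adds no chord condition, since no chord
      starting after \<open>a\<close> ends at \<open>b\<close>.\<close>
    have "proper (c(b := 2)) (a - 1) b"
      unfolding proper_def
    proof (intro conjI allI impI; (elim conjE)?)
      fix i assume "a - 1 \<le> i" "i \<le> b"
      then show "(c(b := 2)) i \<le> 4" using c(1) unfolding proper_def by auto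
    next
      fix i assume i: "a - 1 \<le> i" "i + 1 \<le> b"
      then consider "i + 1 \<le> b - 1" | "i = b - 1" "i \<noteq> b" by linarith
      then show "(c(b := 2)) i \<noteq> (c(b := 2)) (i + 1)"
        using c i unfolding proper_def by cases auto
    next
      fix i assume i: "a - 1 \<le> i" "i + 2 \<le> b" "(c(b := 2)) i = (c(b := 2)) (i + 2)"
      then consider "i + 2 \<le> b - 1" | "i = b - 1 - 1" "i \<noteq> b" "i + 2 = b" by linarith
      then show "(c(b := 2)) i = 0"
        using c i unfolding proper_def by cases auto
    next
      fix x y assume xy: "ch x y" "a - 1 + 2 \<le> x" "y \<le> b"
      then have "y \<noteq> b" using no_end[of x] by auto
      moreover have "x + 2 \<le> y" using chord_span[OF xy(1)] by simp
      ultimately have "x - 1 \<noteq> b" "x \<noteq> b" "y - 1 \<noteq> b" "y \<noteq> b" "y \<le> b - 1" using xy(3) by auto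
      then show "distinct [0, (c(b := 2)) (x - 1), (c(b := 2)) x, (c(b := 2)) (y - 1), (c(b := 2)) y]"
        using proper_chord[OF c(1) xy(1,2)] by simp
    qed
    moreover have "(c(b := 2)) (a - 1) = 1" "(c(b := 2)) a = 3" "(c(b := 2)) (b - 1) = 4" "(c(b := 2)) b = 2"
      using c less.prems(1,2) by auto
    ultimately show ?thesis by blast
  qed
  then obtain c where c: "proper c (a - 1) b" "c (a - 1) = 1" "c a = 3" "c (b - 1) = 4" "c b = 2"
    by blast
  show ?case
    unfolding extendable_def
  proof (intro allI impI)
    fix h p q k :: nat assume hk: "distinct [h, p, q, k]" "set [h, p, q, k] \<subseteq> {1..4}"
    \<comment> \<open>\<open>f\<close> fixes 0 and sends 1, 3, 4, 2 to \<open>h\<close>,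
      \<open>p\<close>, \<open>q\<close>, \<open>k\<close>; injectivity on the five colours
      preserves \<open>proper\<close>.\<close>
    define f :: "nat \<Rightarrow> nat" where
      "f i = (if i = 0 then 0 else if i = 1 then h else if i = 3 then p else if i = 4 then q else k)" for i
    have "{..4::nat} = set [0, 1, 2, 3, 4]" by auto
    moreover have "map f [0, 1, 2, 3, 4] = [0, h, k, p, q]" by (simp add: f_def)
    moreover have "distinct [0, h, k, p, q]" using hk by auto
    ultimately have f: "inj_on f {..4}" by (metis distinct_map)
    have f4: "f i \<le> 4" for i using hk(2) by (simp add: f_def)
    have le: "c i \<le> 4" if "a - 1 \<le> i" "i \<le> b" for i using c(1) that unfolding proper_def by blast
    have "proper (f \<circ> c) (a - 1) b"
      unfolding proper_def
    proof (intro conjI allI impI; (elim conjE)?)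
      fix i assume "a - 1 \<le> i" "i \<le> b"
      then show "(f \<circ> c) i \<le> 4" using f4 by simp
    next
      fix i assume i: "a - 1 \<le> i" "i + 1 \<le> b"
      then have "c i \<noteq> c (i + 1)" using c(1) unfolding proper_def by blast
      then show "(f \<circ> c) i \<noteq> (f \<circ> c) (i + 1)" using le i f by (simp add: inj_on_eq_iff)
    next
      fix i assume i: "a - 1 \<le> i" "i + 2 \<le> b" "(f \<circ> c) i = (f \<circ> c) (i + 2)"
      then have "c i = c (i + 2)" using le f by (simp add: inj_on_eq_iff)
      then have "c i = 0" using c(1) i unfolding proper_def by blast
      then show "(f \<circ> c) i = 0" by (simp add: f_def)
    next
      fix x y assume xy: "ch x y" "a - 1 + 2 \<le> x" "y \<le> b"
      then have "distinct [0, c (x - 1), c x, c (y - 1), c y]" by (rule proper_chord[OF c(1)])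
      moreover have "x + 2 \<le> y" using chord_span[OF xy(1)] by simp
      then have "c (x - 1) \<le> 4" "c x \<le> 4" "c (y - 1) \<le> 4" "c y \<le> 4" using xy by (auto intro!: le)
      ultimately have "distinct (map f [0, c (x - 1), c x, c (y - 1), c y])"
        unfolding distinct_map by (intro conjI inj_on_subset[OF f]; simp)
      moreover have "f 0 = 0" by (simp add: f_def)
      ultimately show "distinct [0, (f \<circ> c) (x - 1), (f \<circ> c) x, (f \<circ> c) (y - 1), (f \<circ> c) y]" by simp
    qed
    then show "\<exists>c. proper c (a - 1) b \<and> c (a - 1) = h \<and> c a = p \<and> c (b - 1) = q \<and> c b = k"
      using c by (intro exI[of _ "f \<circ> c"]) (simp add: f_def)
  qed
qed

text \<open>The cycle is unrolled to the edges 0 to \<open>n + 1\<close>, of which \<open>n\<close>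
  and \<open>n + 1\<close> repeat 0 and 1. The chord splits it into the intervals from 1 to
  \<open>k\<close> and from \<open>k\<close> to \<open>n + 1\<close>, both closed under
  chords.\<close>

lemma ex_cyclic_coloring_chord:
  assumes k: "ch 1 k" "k < n" and n: "\<And>a b. ch a b \<Longrightarrow> b \<le> n"
  shows "\<exists>c. c 0 = c n \<and> c (n + 1) = c 1 \<and> proper c 0 (n + 1) \<and> distinct [0, c 0, c 1, c (k - 1), c k]"
proof -
  have k3: "3 \<le> k" using chord_span[OF k(1)] by simp
  have "closed_interval k (n + 1)"
    unfolding closed_interval_def
  proof (intro allI impI)
    fix x y assume *: "ch x y \<and> (k < x \<and> x < n + 1 \<or> k < y \<and> y < n + 1)"
    then have xy: "x + 2 \<le> y" "1 \<le> x" "k < y" using chord_span[of x y] by auto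
    have "x \<noteq> 1" "x \<noteq> k" using chord_unique[OF k(1), of x y] * xy k3 by auto
    moreover have "\<not> (1 < x \<and> x < k)" using noncrossing[OF k(1), of x y] * xy by auto
    ultimately show "k < x \<and> y < n + 1" using xy n * by fastforce
  qed
  then have "extendable k (n + 1)" using k3 k(2) by (intro extendable_closed_interval) auto
  moreover have "extendable 1 k"
    using k3 closed_interval_chord[OF k(1)] by (intro extendable_closed_interval) auto
  moreover have "distinct [1, 2, 3, 4 :: nat]" "set [1, 2, 3, 4 :: nat] \<subseteq> {1..4}"
      "distinct [3, 4, 1, 2 :: nat]" "set [3, 4, 1, 2 :: nat] \<subseteq> {1..4}"
    by auto
  \<comment> \<open>Both sides see the four edges at the chord, but in opposite order, hence the
    prescriptions 1, 2, 3, 4 and 3, 4, 1, 2.\<close>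
  ultimately obtain c1 c2
    where c1: "proper c1 0 k" "c1 0 = 1" "c1 1 = 2" "c1 (k - 1) = 3" "c1 k = 4"
      and c2: "proper c2 (k - 1) (n + 1)" "c2 (k - 1) = 3" "c2 k = 4" "c2 n = 1" "c2 (n + 1) = 2"
    using extendableD[of 1 k 1 2 3 4] extendableD[of k "n + 1" 3 4 1 2] by auto
  define c where "c i = (if i \<le> k then c1 i else c2 i)" for i
  have e1: "c i = c1 i" if "i \<le> k" for i using that by (simp add: c_def)
  have e2: "c i = c2 i" if "k - 1 \<le> i" for i
    using that c1 c2 by (cases "i = k - 1"; cases "i = k") (auto simp: c_def)
  have "proper c 0 (n + 1)"
    unfolding proper_def
  proof (intro conjI allI impI; (elim conjE)?)
    fix i assume "i \<le> n + 1"
    then show "c i \<le> 4" using c1(1) c2(1) unfolding proper_def c_def by auto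
  next
    fix i assume i: "i + 1 \<le> n + 1"
    show "c i \<noteq> c (i + 1)"
    proof (cases "i + 1 \<le> k")
      case True
      then show ?thesis using c1(1) e1[of i] e1[of "i + 1"] unfolding proper_def by auto
    next
      case False
      then show ?thesis using c2(1) i e2[of i] e2[of "i + 1"] unfolding proper_def by auto
    qed
  next
    fix i assume i: "i + 2 \<le> n + 1" "c i = c (i + 2)"
    show "c i = 0"
    proof (cases "i + 2 \<le> k")
      case True
      then show ?thesis using c1(1) i(2) e1[of i] e1[of "i + 2"] unfolding proper_def by auto
    next
      case False
      then show ?thesis using c2(1) i e2[of i] e2[of "i + 2"] unfolding proper_def by auto
    qed
  next
    fix a b assume ab: "ch a b" "0 + 2 \<le> a" "b \<le> n + 1"
    have ab2: "a + 2 \<le> b" using chord_span[OF ab(1)] by simp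
    show "distinct [0, c (a - 1), c a, c (b - 1), c b]"
    proof (cases "a < k")
      case True
      then have "b < k" using noncrossing[OF k(1) ab(1)] ab(2) by simp
      then show ?thesis
        using proper_chord[OF c1(1) ab(1,2)] ab2 e1[of "a - 1"] e1[of a] e1[of "b - 1"] e1[of b] by simp
    next
      case False
      have "a \<noteq> k" using chord_unique[OF k(1) ab(1)] ab(2) by auto
      then show ?thesis
        using proper_chord[OF c2(1) ab(1) _ ab(3)] False ab2 k3
          e2[of "a - 1"] e2[of a] e2[of "b - 1"] e2[of b] by simp
    qed
  qed
  moreover have "c 0 = 1" "c 1 = 2" "c (k - 1) = 3" "c k = 4" "c n = 1" "c (n + 1) = 2"
    using c1 c2 e1[of 0] e1[of 1] e1[of "k - 1"] e1[of k] e2[of n] e2[of "n + 1"] k3 k(2) by simp_all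
  ultimately show ?thesis by (intro exI[of _ c]) simp
qed

text \<open>Edges 0 and \<open>n\<close> are one edge of the cycle but get different colours on the
  path, so it moves to the matching. Its neighbours 1 and \<open>n - 1\<close> have the colours 3
  and 4, hence edge \<open>n + 1\<close> can repeat the 3.\<close>

lemma ex_cyclic_coloring_no_chord:
  assumes "3 \<le> n" "\<And>a b. \<not> ch a b"
  shows "\<exists>c. c 0 = c n \<and> c (n + 1) = c 1 \<and> proper c 0 (n + 1)"
proof -
  have "extendable 1 n"
    using assms by (intro extendable_closed_interval) (auto simp: closed_interval_def)
  moreover have "distinct [1, 3, 4, 2 :: nat]" "set [1, 3, 4, 2 :: nat] \<subseteq> {1..4}" by auto
  ultimately obtain d where d: "proper d 0 n" "d 1 = 3" "d (n - 1) = 4"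
    using extendableD[of 1 n 1 3 4 2] by auto
  define c where "c i = (if i = 0 \<or> i = n then 0 else if i = n + 1 then 3 else d i)" for i
  have "proper c 0 (n + 1)"
    unfolding proper_def
  proof (intro conjI allI impI; (elim conjE)?)
    fix i assume "i \<le> n + 1"
    then show "c i \<le> 4" using d(1) unfolding proper_def c_def by auto
  next
    fix i assume "i + 1 \<le> n + 1"
    then consider "i = 0" | "i = n" | "i = n - 1" "i \<noteq> 0" | "0 < i" "i + 1 < n" by linarith
    then show "c i \<noteq> c (i + 1)"
      using d assms(1) unfolding proper_def c_def by cases auto
  next
    fix i assume i: "i + 2 \<le> n + 1" "c i = c (i + 2)"
    then consider "i = 0" | "i = n - 1" "i + 2 = n + 1" "i \<noteq> 0" | "i + 2 = n" | "0 < i" "i + 2 < n" by linarith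
    then show "c i = 0"
    proof cases
      case 2
      moreover have "i \<noteq> n" "i \<noteq> n + 1" using 2 by linarith+
      ultimately have "c i = 4" "c (i + 2) = 3" using d(3) by (simp_all add: c_def)
      then show ?thesis using i(2) by simp
    next
      case 4
      then have "d i = d (i + 2)" using i by (simp add: c_def)
      then have "d i = 0" using d(1) 4 unfolding proper_def by auto
      then show ?thesis using 4 by (simp add: c_def)
    qed (use d assms(1) i in \<open>auto simp: c_def\<close>)
  qed (use assms(2) in blast)
  then show ?thesis using assms(1) d by (intro exI[of _ c]) (auto simp: c_def)
qed

end

section \<open>From the Hamiltonian cycle to the packing colouring\<close>

text \<open>Edges at distance 1 share an end; for edges at distance 2 some edge meets both. These
  are the only obstructions to the two kinds of classes.\<close>

lemma edge_dist_ge_2: "e \<noteq> f \<Longrightarrow> e \<inter> f = {} \<Longrightarrow> edge_dist E e f \<ge> 2"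
  and edge_dist_ge_3: "e \<noteq> f \<Longrightarrow> e \<inter> f = {} \<Longrightarrow> (\<And>g. g \<in> E \<Longrightarrow> g \<inter> e \<noteq> {} \<Longrightarrow> g \<inter> f \<noteq> {} \<Longrightarrow> False)
    \<Longrightarrow> edge_dist E e f \<ge> 3"
proof -
  assume ef: "e \<noteq> f" "e \<inter> f = {}"
  have line: "x \<inter> y \<noteq> {}" if "{x, y} \<in> line_graph_edges E" for x y
    using that unfolding line_graph_edges_def by (auto simp: doubleton_eq_iff)
  have len: "3 \<le> length xs" if "xs \<in> walks E (line_graph_edges E) e f" for xs
  proof (rule ccontr)
    assume "\<not> 3 \<le> length xs"
    then consider "xs = []" | x where "xs = [x]" | x y where "xs = [x, y]"
      by (cases xs; cases "tl xs"; cases "tl (tl xs)") auto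
    then show False using that ef line by cases (auto simp: walks_def)
  qed
  have "enat 2 \<le> enat (length xs - 1)" if "xs \<in> walks E (line_graph_edges E) e f" for xs
    using len[OF that] by simp
  then show "edge_dist E e f \<ge> 2"
    unfolding edge_dist_def graph_dist_def by (auto intro!: INF_greatest simp: numeral_eq_enat)
  assume no: "\<And>g. g \<in> E \<Longrightarrow> g \<inter> e \<noteq> {} \<Longrightarrow> g \<inter> f \<noteq> {} \<Longrightarrow> False"
  have "enat 3 \<le> enat (length xs - 1)" if xs: "xs \<in> walks E (line_graph_edges E) e f" for xs
  proof (rule ccontr)
    assume "\<not> enat 3 \<le> enat (length xs - 1)"
    then have "length xs = 3" using len[OF xs] by simp
    then obtain x y z where "xs = [x, y, z]" by (auto simp: numeral_3_eq_3 length_Suc_conv)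
    then show False using xs no[of y] line[of e y] line[of y f] by (auto simp: walks_def)
  qed
  then show "edge_dist E e f \<ge> 3"
    unfolding edge_dist_def graph_dist_def by (auto intro!: INF_greatest simp: numeral_eq_enat)
qed

text \<open>The cycle is numbered periodically by all natural numbers: the closing edge is a step
  like any other, and rotating the cycle is a shift of the index.\<close>

locale hamiltonian_graph =
  fixes V :: "'a set" and E :: "'a set set" and n :: nat and v :: "nat \<Rightarrow> 'a"
  assumes graph: "simple_graph V E" and cubic: "subcubic V E"
    and n3: "3 \<le> n"
    and v_eq: "v i = v j \<longleftrightarrow> i mod n = j mod n"
    and range_v: "range v = V"
    and step: "{v i, v (i + 1)} \<in> E"
begin

text \<open>Ends are represented in 1 to \<open>n\<close>, so that \<open>a - 1\<close> is a genuine
  index. The pair 1, \<open>n\<close> is excluded because it is the closing edge of the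
  cycle.\<close>

definition chord :: "nat \<Rightarrow> nat \<Rightarrow> bool" where
  "chord a b \<longleftrightarrow> 1 \<le> a \<and> a + 2 \<le> b \<and> b \<le> n \<and> \<not> (a = 1 \<and> b = n) \<and> {v a, v b} \<in> E"

section \<open>Indices modulo n and the matching of chords\<close>

lemma v_add_n: "v (i + n) = v i"
  by (simp add: v_eq)

lemma v_eq_add: "v i = v (i + d) \<longleftrightarrow> n dvd d"
  unfolding v_eq by (metis add_diff_cancel_left' le_add1 mod_eq_dvd_iff_nat)

lemma v_inj_window:
  assumes "s \<le> i" "i < s + n" "s \<le> j" "j < s + n" "v i = v j"
  shows "i = j"
  using assms
proof (induction i j rule: linorder_wlog)
  case (le i j)
  then have "n dvd j - i" using v_eq_add[of i "j - i"] by simp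
  moreover have "j - i < n" using le.prems by linarith
  ultimately have "j - i = 0" using nat_dvd_not_less by blast
  then show ?case using le by simp
qed metis

lemma v_inj: "i \<in> {1..n} \<Longrightarrow> j \<in> {1..n} \<Longrightarrow> v i = v j \<Longrightarrow> i = j"
  using v_inj_window[of 1 i j] by simp

lemma v_surj:
  assumes "x \<in> V"
  obtains i where "i \<in> {1..n}" "v i = x"
proof -
  obtain j where j: "v j = x" using assms range_v by blast
  show ?thesis
  proof (cases "j mod n = 0")
    case True
    then show ?thesis using that[of n] j v_eq[of n j] n3 by auto
  next
    case False
    moreover have "j mod n < n" using n3 by simp
    ultimately show ?thesis using that[of "j mod n"] j v_eq[of "j mod n" j] by auto
  qed
qed

text \<open>Two of the at most three edges at \<open>v a\<close> belong to the cycle. The index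
  \<open>a + (n - 1)\<close> stands for the predecessor of \<open>a\<close>.\<close>

lemma inner_edge_unique:
  assumes "{v a, v b} \<in> E" "v b \<noteq> v (a + 1)" "v b \<noteq> v (a + (n - 1))"
    and "{v a, v b'} \<in> E" "v b' \<noteq> v (a + 1)" "v b' \<noteq> v (a + (n - 1))"
  shows "v b = v b'"
proof (rule ccontr)
  assume ne: "v b \<noteq> v b'"
  have "v (a + 1) \<noteq> v (a + (n - 1))"
  proof
    assume "v (a + 1) = v (a + (n - 1))"
    moreover have "a + (n - 1) = a + 1 + (n - 2)" using n3 by simp
    ultimately have "n dvd n - 2" using v_eq_add[of "a + 1" "n - 2"] by metis
    then show False using n3 by (auto dest: dvd_imp_le)
  qed
  then have "card {v (a + 1), v (a + (n - 1)), v b, v b'} = 4" using ne assms by auto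
  moreover have "inj_on (\<lambda>x. {v a, x}) S" for S by (auto simp: inj_on_def doubleton_eq_iff)
  ultimately have four: "card ((\<lambda>x. {v a, x}) ` {v (a + 1), v (a + (n - 1)), v b, v b'}) = 4"
    by (metis card_image)
  have "v (a + (n - 1) + 1) = v a" using v_add_n[of a] n3 by simp
  then have "{v a, v (a + (n - 1))} \<in> E" using step[of "a + (n - 1)"] by (simp add: insert_commute)
  then have sub: "(\<lambda>x. {v a, x}) ` {v (a + 1), v (a + (n - 1)), v b, v b'} \<subseteq> {e \<in> E. v a \<in> e}"
    using assms step[of a] by auto
  have "finite E"
  proof (rule finite_subset)
    show "E \<subseteq> Pow V" "finite (Pow V)" using graph unfolding simple_graph_def by auto
  qed
  then have "finite {e \<in> E. v a \<in> e}" by simp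
  then have "4 \<le> degree E (v a)" unfolding degree_def using card_mono[OF _ sub] four by simp
  moreover have "v a \<in> V" using range_v by blast
  ultimately show False using cubic unfolding subcubic_def by fastforce
qed

lemma chord_not_step:
  assumes "chord a b"
  shows "v b \<noteq> v (a + 1)" "v b \<noteq> v (a + (n - 1))" "v a \<noteq> v (b + 1)" "v a \<noteq> v (b + (n - 1))"
proof -
  have ab: "1 \<le> a" "a + 2 \<le> b" "b \<le> n" "\<not> (a = 1 \<and> b = n)" using assms unfolding chord_def by auto
  have nd: "\<not> n dvd d" if "0 < d" "d < n" for d using that by (simp add: nat_dvd_not_less)
  have "0 < b - (a + 1)" "b - (a + 1) < n" "b = a + 1 + (b - (a + 1))" using ab by linarith+
  then show "v b \<noteq> v (a + 1)" using nd v_eq_add[of "a + 1" "b - (a + 1)"] by metis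
  have "0 < a + (n - 1) - b" "a + (n - 1) - b < n" "a + (n - 1) = b + (a + (n - 1) - b)"
    using ab n3 by linarith+
  then show "v b \<noteq> v (a + (n - 1))" using nd v_eq_add[of b "a + (n - 1) - b"] by metis
  have "0 < b + 1 - a" "b + 1 - a < n" "b + 1 = a + (b + 1 - a)" using ab by linarith+
  then show "v a \<noteq> v (b + 1)" using nd v_eq_add[of a "b + 1 - a"] by metis
  have "0 < b - 1 - a" "b - 1 - a < n" using ab by linarith+
  then have "\<not> n dvd (b - 1 - a) + n" using nd dvd_add_triv_right_iff by blast
  moreover have "b + (n - 1) = a + ((b - 1 - a) + n)" using ab n3 by linarith
  ultimately show "v a \<noteq> v (b + (n - 1))" using v_eq_add[of a "(b - 1 - a) + n"] by simp
qed

lemma chord_unique: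
  assumes "chord a b" "chord a' b'" "{a, b} \<inter> {a', b'} \<noteq> {}"
  shows "a = a' \<and> b = b'"
proof -
  have r: "a \<in> {1..n}" "b \<in> {1..n}" "a' \<in> {1..n}" "b' \<in> {1..n}" "a < b" "a' < b'"
    and E: "{v a, v b} \<in> E" "{v b, v a} \<in> E" "{v a', v b'} \<in> E" "{v b', v a'} \<in> E"
    using assms(1,2) unfolding chord_def by (auto simp: insert_commute)
  note n1 = chord_not_step[OF assms(1)] and n2 = chord_not_step[OF assms(2)]
  consider "a = a'" | "b = b'" | "a = b'" | "b = a'" using assms(3) by auto
  then show ?thesis
  proof cases
    case 1
    then show ?thesis using inner_edge_unique[of a b b'] E n1 n2 v_inj[OF r(2,4)] by simp
  next
    case 2
    then show ?thesis using inner_edge_unique[of b a a'] E n1 n2 v_inj[OF r(1,3)] by simp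
  next
    case 3
    then have "v b = v a'" using inner_edge_unique[of a b a'] E n1 n2 by simp
    then show ?thesis using v_inj[OF r(2,3)] 3 r by simp
  next
    case 4
    then have "v a = v b'" using inner_edge_unique[of b a b'] E n1 n2 by simp
    then show ?thesis using v_inj[OF r(1,4)] 4 r by simp
  qed
qed

lemma edge_cases:
  assumes "e \<in> E"
  shows "(\<exists>i\<in>{1..n}. e = {v i, v (i + 1)}) \<or> (\<exists>a b. chord a b \<and> e = {v a, v b})"
proof -
  have "e \<subseteq> V" "card e = 2" using assms graph unfolding simple_graph_def by auto
  then obtain x y where xy: "e = {x, y}" "x \<noteq> y" "x \<in> V" "y \<in> V" by (auto simp: card_2_iff)
  obtain i j where ij: "i \<in> {1..n}" "v i = x" "j \<in> {1..n}" "v j = y"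
    using v_surj xy by metis
  have *: ?thesis if ab: "a \<in> {1..n}" "b \<in> {1..n}" "a < b" "e = {v a, v b}" for a b
  proof -
    consider "b = a + 1" | "a = 1" "b = n" | "chord a b"
      using ab assms unfolding chord_def by fastforce
    then show ?thesis
    proof cases
      case 1
      then show ?thesis using ab by blast
    next
      case 2
      then have "e = {v n, v (n + 1)}" using ab v_add_n[of 1] by (simp add: insert_commute add.commute)
      moreover have "n \<in> {1..n}" using n3 by simp
      ultimately show ?thesis by blast
    next
      case 3
      then show ?thesis using ab by blast
    qed
  qed
  have "i \<noteq> j" using xy ij by auto
  then show ?thesis using *[of i j] *[of j i] ij xy by (auto simp: insert_commute neq_iff)
qed

text \<open>Equality with the ends exchanged would give \<open>v j = v (j + 2)\<close>, impossible
  for \<open>n \<ge> 3\<close>.\<close>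

lemma step_inj:
  assumes "{v i, v (i + 1)} = {v j, v (j + 1)}"
  shows "i mod n = j mod n"
proof (rule ccontr)
  assume "i mod n \<noteq> j mod n"
  then have "v i = v (j + 1)" "v (i + 1) = v j" using assms v_eq by (auto simp: doubleton_eq_iff)
  then have "v j = v (j + 2)" unfolding v_eq by (metis add.assoc mod_add_left_eq one_add_one)
  then have "n dvd 2" by (simp only: v_eq_add)
  then show False using n3 by (auto dest: dvd_imp_le)
qed

lemma step_at:
  assumes "1 \<le> a" "v a \<in> {v i, v (i + 1)}"
  shows "i mod n = a mod n \<or> i mod n = (a - 1) mod n"
proof -
  consider "v a = v i" | "v (a - 1 + 1) = v (i + 1)" using assms by auto
  then show ?thesis
  proof cases
    case 1
    then show ?thesis using v_eq by metis
  next
    case 2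
    then have "(a - 1 + 1 + (n - 1)) mod n = (i + 1 + (n - 1)) mod n"
      unfolding v_eq by (metis mod_add_left_eq)
    moreover have "a - 1 + 1 + (n - 1) = a - 1 + n" "i + 1 + (n - 1) = i + n" using n3 by simp_all
    ultimately show ?thesis by (metis mod_add_self2)
  qed
qed

text \<open>Class 0 holds the chords and the cycle edges of colour 0. It is a matching, since chords
  share no ends, consecutive cycle edges differ, and \<open>cc\<close> keeps colour 0 away from
  chord ends. In any other class, an edge meeting two members is a cycle edge, ruled out by
  \<open>c1\<close> and \<open>c2\<close>, or a chord, ruled out by \<open>cc\<close>.\<close>

lemma packing_of_cyclic_coloring:
  fixes c :: "nat \<Rightarrow> nat"
  assumes per: "\<And>i j. i mod n = j mod n \<Longrightarrow> c i = c j" and le: "\<And>i. c i \<le> 4"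
    and c1: "\<And>i. c i \<noteq> c (i + 1)" and c2: "\<And>i. c i = c (i + 2) \<Longrightarrow> c i = 0"
    and cc: "\<And>a b. chord a b \<Longrightarrow> distinct [0, c (a - 1), c a, c (b - 1), c b]"
  shows "\<exists>C. packing_edge_coloring [1, 2, 2, 2, 2] E C"
proof -
  define R where "R = {e. \<exists>i. e = {v i, v (i + 1)}}"
  define H where "H = {e. \<exists>a b. chord a b \<and> e = {v a, v b}}"
  define C where "C k = {e. \<exists>i. e = {v i, v (i + 1)} \<and> c i = k} \<union> (if k = 0 then H else {})" for k :: nat
  have RH: "R \<inter> H = {}"
  proof (rule ccontr)
    assume "R \<inter> H \<noteq> {}"
    then obtain i a b where ab: "chord a b" "{v i, v (i + 1)} = {v a, v b}" unfolding R_def H_def by auto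
    then consider "v i = v a" "v (i + 1) = v b" | "v i = v b" "v (i + 1) = v a" by (auto simp: doubleton_eq_iff)
    then show False
      using chord_not_step[OF ab(1)] by cases (metis v_eq mod_add_left_eq)+
  qed
  have U: "(\<Union>k<5. C k) = E"
  proof
    show "(\<Union>k<5. C k) \<subseteq> E" using step unfolding C_def H_def chord_def by (auto split: if_splits)
    show "E \<subseteq> (\<Union>k<5. C k)"
    proof
      fix e assume "e \<in> E"
      then consider i where "e = {v i, v (i + 1)}" | a b where "chord a b" "e = {v a, v b}"
        using edge_cases by blast
      then show "e \<in> (\<Union>k<5. C k)"
      proof cases
        case (1 i)
        then have "e \<in> C (c i)" unfolding C_def by blast
        moreover have "c i < 5" using le[of i] by simp
        ultimately show ?thesis by blast
      next
        case (2 a b)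
        then have "e \<in> C 0" unfolding C_def H_def by auto
        then show ?thesis by (intro UN_I[of 0]) simp_all
      qed
    qed
  qed
  have D: "disjoint_family_on C {..<5}"
    unfolding disjoint_family_on_def
  proof (intro ballI impI)
    fix k l :: nat assume "k \<noteq> l"
    show "C k \<inter> C l = {}"
    proof (rule ccontr)
      assume "C k \<inter> C l \<noteq> {}"
      then obtain e where e: "e \<in> C k" "e \<in> C l" by blast
      show False
      proof (cases "e \<in> H")
        case True
        then have "e \<notin> R" using RH by blast
        then show False using e \<open>k \<noteq> l\<close> unfolding C_def R_def by (auto split: if_splits)
      next
        case False
        then obtain i j where "e = {v i, v (i + 1)}" "c i = k" "e = {v j, v (j + 1)}" "c j = l"
          using e unfolding C_def by (auto split: if_splits)
        then show False using step_inj[of i j] per[of i j] \<open>k \<noteq> l\<close> by simp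
      qed
    qed
  qed
  define Ed where "Ed i = {v i, v (i + 1)}" for i
  have Ed_per: "Ed i = Ed j" if "i mod n = j mod n" for i j
    using that v_eq unfolding Ed_def by (metis mod_add_left_eq)
  have at: "Ed i = Ed a \<and> c i = c a \<or> Ed i = Ed (a - 1) \<and> c i = c (a - 1)" if "1 \<le> a" "v a \<in> Ed i" for a i
    using step_at[of a i] that Ed_per per unfolding Ed_def by blast
  \<comment> \<open>Adding \<open>n\<close> to an index gives a positive one, so that
    \<open>a - 1\<close> really is the previous edge.\<close>
  have vert: "\<exists>a. 1 \<le> a \<and> x = v a" if "x \<in> Ed i" for x i
    using that v_add_n[of i] n3 unfolding Ed_def
    by (metis One_nat_def Suc_leI add_gr_0 insertE le_add2 numeral_3_eq_3 order_trans singletonD trans_le_add2 zero_less_Suc)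
  have c1': "c (a - 1) \<noteq> c a" if "1 \<le> a" for a using c1[of "a - 1"] that by simp
  have share: False if ne: "Ed i \<noteq> Ed j" and ce: "c i = c j" and x: "Ed i \<inter> Ed j \<noteq> {}" for i j
  proof -
    obtain a where "1 \<le> a" "v a \<in> Ed i" "v a \<in> Ed j" using x vert by blast
    then show False using at[of a i] at[of a j] c1'[of a] ne ce by auto
  qed
  have conflict: "e \<inter> f = {}" if "e \<in> C 0" "f \<in> C 0" "e \<noteq> f" for e f
  proof -
    have EH: False if g: "g \<in> H" and ci: "c i = 0" and x: "Ed i \<inter> g \<noteq> {}" for g i
    proof -
      obtain a b where ab: "chord a b" "g = {v a, v b}" using g unfolding H_def by blast
      then have "1 \<le> a" "1 \<le> b" unfolding chord_def by auto
      then show False using ci x ab cc[OF ab(1)] at[of a i] at[of b i] by auto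
    qed
    have HH: "e = f" if eH: "e \<in> H" and fH: "f \<in> H" and x: "e \<inter> f \<noteq> {}"
    proof -
      obtain a b a' b' where ab: "chord a b" "e = {v a, v b}" "chord a' b'" "f = {v a', v b'}"
        using eH fH unfolding H_def by blast
      then have "v ` {a, b} \<inter> v ` {a', b'} \<noteq> {}" using x by simp
      then obtain s t where st: "s \<in> {a, b}" "t \<in> {a', b'}" "v s = v t" by blast
      moreover have "{a, b} \<subseteq> {1..n}" "{a', b'} \<subseteq> {1..n}" using ab unfolding chord_def by auto
      ultimately have "s = t" using v_inj by blast
      then have "{a, b} \<inter> {a', b'} \<noteq> {}" using st by blast
      then have "a = a' \<and> b = b'" by (rule chord_unique[OF ab(1,3)])
      then show ?thesis using ab(2,4) by simp
    qed
    have cs: "g \<in> H \<or> (\<exists>i. g = Ed i \<and> c i = 0)" if "g \<in> C 0" for g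
      using that unfolding C_def Ed_def by auto
    show ?thesis
      using cs[OF \<open>e \<in> C 0\<close>] cs[OF \<open>f \<in> C 0\<close>] \<open>e \<noteq> f\<close> EH HH share by (metis inf_commute)
  qed
  have conflict3: "edge_dist E e f \<ge> 3" if k: "k \<noteq> 0" and e: "e \<in> C k" and f: "f \<in> C k" and ef: "e \<noteq> f" for e f k
  proof -
    obtain i j where ij: "e = Ed i" "f = Ed j" "c i = k" "c j = k"
      using k e f unfolding C_def Ed_def by auto
    show ?thesis
    proof (rule edge_dist_ge_3[OF ef])
      show "e \<inter> f = {}" using share ij ef by blast
      fix g assume g: "g \<in> E" "g \<inter> e \<noteq> {}" "g \<inter> f \<noteq> {}"
      consider m where "m \<in> {1..n}" "g = {v m, v (m + 1)}" | a b where "chord a b" "g = {v a, v b}"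
        using edge_cases[OF g(1)] by blast
      then show False
      proof cases
        case (1 m)
        have near: "Ed l = Ed (m - 1) \<and> c l = c (m - 1) \<or> Ed l = Ed m \<and> c l = c m \<or> Ed l = Ed (m + 1) \<and> c l = c (m + 1)"
          if "g \<inter> Ed l \<noteq> {}" for l
          using that 1 at[of m l] at[of "m + 1" l] by auto
        have "c (m - 1) \<noteq> c m" "c m \<noteq> c (m + 1)" "c (m - 1) = c (m + 1) \<Longrightarrow> c (m - 1) = 0"
          using c1[of "m - 1"] c1[of m] c2[of "m - 1"] 1(1) by auto
        then show False using near[of i] near[of j] g ij ef k by auto
      next
        case (2 a b)
        then have "1 \<le> a" "1 \<le> b" unfolding chord_def by auto
        have near: "Ed l = Ed (a - 1) \<and> c l = c (a - 1) \<or> Ed l = Ed a \<and> c l = c a \<or>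
            Ed l = Ed (b - 1) \<and> c l = c (b - 1) \<or> Ed l = Ed b \<and> c l = c b"
          if "g \<inter> Ed l \<noteq> {}" for l
          using that 2 at[OF \<open>1 \<le> a\<close>, of l] at[OF \<open>1 \<le> b\<close>, of l] by auto
        have "e = Ed (a - 1) \<and> k = c (a - 1) \<or> e = Ed a \<and> k = c a \<or>
            e = Ed (b - 1) \<and> k = c (b - 1) \<or> e = Ed b \<and> k = c b"
          "f = Ed (a - 1) \<and> k = c (a - 1) \<or> f = Ed a \<and> k = c a \<or>
            f = Ed (b - 1) \<and> k = c (b - 1) \<or> f = Ed b \<and> k = c b"
          using near[of i] near[of j] g(2,3) ij by simp_all
        moreover have "c (a - 1) \<noteq> c a" "c (a - 1) \<noteq> c (b - 1)" "c (a - 1) \<noteq> c b" "c a \<noteq> c (b - 1)"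
            "c a \<noteq> c b" "c (b - 1) \<noteq> c b"
          using cc[OF 2(1)] by simp_all
        ultimately show False using ef by (elim disjE conjE) (simp_all only: simp_thms)
      qed
    qed
  qed
  have "edge_dist E e f \<ge> enat ([1, 2, 2, 2, 2] ! k + 1)"
    if "k < 5" "e \<in> C k" "f \<in> C k" "e \<noteq> f" for k e f
  proof (cases "k = 0")
    case True
    then have "[1, 2, 2, 2, 2] ! k + 1 = (2 :: nat)" by simp
    moreover have "enat 2 \<le> edge_dist E e f"
      using edge_dist_ge_2[of e f E] conflict[of e f] that True by (simp add: numeral_eq_enat)
    ultimately show ?thesis by metis
  next
    case False
    then have "[1, 2, 2, 2, 2] ! k + 1 = (3 :: nat)"
      using that(1) by (auto simp: less_Suc_eq numeral_eq_Suc)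
    moreover have "enat 3 \<le> edge_dist E e f"
      using conflict3[OF False that(2,3,4)] by (simp add: numeral_eq_enat)
    ultimately show ?thesis by metis
  qed
  then show ?thesis
    using U D unfolding packing_edge_coloring_def by (intro exI[of _ C]) (simp add: numeral_eq_Suc)
qed

section \<open>Crossing chords\<close>

lemma walk_upt: "walk E (map v [i..<j])"
proof (induction j)
  case (Suc j)
  show ?case
  proof (cases "i < j")
    case True
    then obtain k where k: "j = Suc k" "i \<le> k" by (cases j) auto
    then have "last (map v [i..<j]) = v k" by simp
    then show ?thesis using Suc k True step[of k] by (auto simp: successively_append_iff)
  next
    case False
    then show ?thesis using Suc by (cases "i = j") auto
  qed
qed simp

text \<open>The theta has branch vertices \<open>v s\<close> and \<open>v t\<close>. One path
  follows the cycle, one takes the chord to \<open>u\<close> and walks back to \<open>t\<close>, one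
  walks backwards from \<open>s\<close> to \<open>w\<close> and takes the other chord. Only the
  first might lack inner vertices, which \<open>s + 2 \<le> t\<close> prevents.\<close>

lemma theta_of_crossing:
  assumes "s + 2 \<le> t" "t < u" "u < w" "w < s + n" "{v s, v u} \<in> E" "{v t, v w} \<in> E"
  shows "\<not> theta_free E"
proof -
  define A where "A = map v [s + 1..<t]"
  define B where "B = rev (map v [t + 1..<u + 1])"
  define C where "C = rev (map v [w..<s + n])"
  have "v s # A @ [v t] = map v [s..<t + 1]"
    using assms unfolding A_def by (simp add: upt_conv_Cons)
  then have A: "walk E (v s # A @ [v t])" using walk_upt by metis
  have "v s # B @ [v t] = v s # rev (map v [t..<u + 1])"
    using assms unfolding B_def by (simp add: upt_conv_Cons)
  moreover have "hd (rev (map v [t..<u + 1])) = v u" using assms by (simp add: hd_rev)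
  then have "walk E (v s # rev (map v [t..<u + 1]))"
    using assms walk_rev[of E "map v [t..<u + 1]"] walk_upt[of t "u + 1"]
    by (simp add: successively_Cons del: upt_Suc)
  ultimately have B: "walk E (v s # B @ [v t])" by metis
  have "v s # C @ [v t] = rev (map v [w..<s + n + 1]) @ [v t]"
    using assms v_add_n[of s] unfolding C_def by simp
  moreover have "last (rev (map v [w..<s + n + 1])) = v w"
    using assms by (simp add: last_rev upt_conv_Cons del: upt_Suc)
  then have "walk E (rev (map v [w..<s + n + 1]) @ [v t])"
    using assms walk_rev[of E "map v [w..<s + n + 1]"] walk_upt
    by (simp add: successively_append_iff insert_commute del: upt_Suc)
  ultimately have C: "walk E (v s # C @ [v t])" by metis
  define I where "I = s # t # [s + 1..<t] @ rev [t + 1..<u + 1] @ rev [w..<s + n]"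
  have "distinct I" "set I \<subseteq> {s..<s + n}" using assms unfolding I_def by auto
  moreover have "inj_on v {s..<s + n}" using v_inj_window by (auto intro!: inj_onI)
  ultimately have "distinct (map v I)" unfolding distinct_map by (blast intro: inj_on_subset)
  moreover have "map v I = v s # v t # A @ B @ C" unfolding I_def A_def B_def C_def by (simp add: rev_map)
  ultimately have "distinct (v s # v t # A @ B @ C)" by metis
  moreover have "A \<noteq> []" "B \<noteq> []" "C \<noteq> []" using assms unfolding A_def B_def C_def by auto
  ultimately show ?thesis using A B C unfolding theta_free_def by blast
qed

text \<open>The ends of two crossing chords cut the cycle into four arcs. Unless
  \<open>n = 4\<close>, one of them has an inner vertex and can serve as the arc from
  \<open>s\<close> to \<open>t\<close> of the theta.\<close>

lemma noncrossing_chords_chord: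
  assumes "theta_free E" "n \<noteq> 4"
  shows "noncrossing_chords chord"
proof
  show "1 \<le> a \<and> a + 2 \<le> b" if "chord a b" for a b using that unfolding chord_def by simp
  show "a = a' \<and> b = b'" if "chord a b" "chord a' b'" "{a, b} \<inter> {a', b'} \<noteq> {}" for a b a' b'
    using chord_unique that by blast
  show "b' < b" if ch: "chord a b" "chord a' b'" and cross: "a < a'" "a' < b" for a b a' b'
  proof (rule ccontr)
    assume "\<not> b' < b"
    moreover have "b \<noteq> b'" using chord_unique[OF ch] cross by auto
    ultimately have "b < b'" by simp
    have E: "{v a, v b} \<in> E" "{v a', v b'} \<in> E" and r: "1 \<le> a" "b' \<le> n"
      using ch unfolding chord_def by auto
    \<comment> \<open>Raising indices by \<open>n\<close> allows the four ends to be read cyclically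
      from any of them.\<close>
    then have E': "{v b, v (a + n)} \<in> E" "{v b', v (a' + n)} \<in> E" "{v (a + n), v (b + n)} \<in> E"
      by (simp_all add: v_add_n insert_commute)
    consider "a + 2 \<le> a'" | "a' + 2 \<le> b" | "b + 2 \<le> b'" | "b' + 2 \<le> a + n"
      using cross \<open>b < b'\<close> r assms(2) n3 by linarith
    then have "\<not> theta_free E"
    proof cases
      case 1
      show ?thesis by (rule theta_of_crossing[OF 1 cross(2) \<open>b < b'\<close> _ E]) (use r in simp)
    next
      case 2
      show ?thesis by (rule theta_of_crossing[OF 2 \<open>b < b'\<close> _ _ E(2) E'(1)]) (use r cross in simp_all)
    next
      case 3
      show ?thesis by (rule theta_of_crossing[OF 3 _ _ _ E'(1,2)]) (use r cross \<open>b < b'\<close> in simp_all)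
    next
      case 4
      show ?thesis by (rule theta_of_crossing[OF 4 _ _ _ E'(2,3)]) (use r cross \<open>b < b'\<close> in simp_all)
    qed
    then show False using assms(1) by blast
  qed
qed

text \<open>\<open>proper c 0\<close> does not reach a chord that begins at 1, hence the assumption
  \<open>one\<close>. The repeated edges \<open>n\<close> and \<open>n + 1\<close> carry the
  conditions across the cut.\<close>

lemma packing_of_cyclic_proper:
  fixes c :: "nat \<Rightarrow> nat"
  assumes nc: "noncrossing_chords chord"
    and c: "c 0 = c n" "c (n + 1) = c 1" "noncrossing_chords.proper chord c 0 (n + 1)"
    and one: "\<And>k. chord 1 k \<Longrightarrow> distinct [0, c 0, c 1, c (k - 1), c k]"
  shows "\<exists>C. packing_edge_coloring [1, 2, 2, 2, 2] E C"
proof -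
  interpret noncrossing_chords chord by (rule nc)
  define d where "d i = c (i mod n)" for i
  have mn: "i mod n < n" for i using n3 by simp
  have d1: "d (i + 1) = c (i mod n + 1)" for i
  proof (cases "i mod n + 1 = n")
    case True
    then have "(i + 1) mod n = 0" by (metis mod_add_left_eq mod_self)
    then show ?thesis using True c(1) unfolding d_def by simp
  next
    case False
    then have "i mod n + 1 < n" using mn[of i] by simp
    then have "(i + 1) mod n = i mod n + 1" by (metis mod_add_left_eq mod_less)
    then show ?thesis unfolding d_def by simp
  qed
  have d2: "d (i + 2) = c (i mod n + 2)" for i
  proof (cases "i mod n + 1 = n")
    case True
    then have "(i + 1) mod n = 0" by (metis mod_add_left_eq mod_self)
    moreover have "i mod n + 2 = n + 1" using True by simp
    ultimately show ?thesis using d1[of "i + 1"] c(2) by (simp add: numeral_2_eq_2)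
  next
    case False
    then have "i mod n + 1 < n" using mn[of i] by simp
    then have "(i + 1) mod n = i mod n + 1" by (metis mod_add_left_eq mod_less)
    then show ?thesis using d1[of "i + 1"] by (simp add: numeral_2_eq_2)
  qed
  have dc: "d i = c i" if "i \<le> n" for i
    using that c(1) unfolding d_def by (cases "i = n") auto
  show ?thesis
  proof (rule packing_of_cyclic_coloring[of d])
    show "d i = d j" if "i mod n = j mod n" for i j using that unfolding d_def by simp
    show "d i \<le> 4" for i using c(3) mn[of i] unfolding proper_def d_def by simp
    show "d i \<noteq> d (i + 1)" for i
      using c(3) mn[of i] unfolding d1 unfolding proper_def d_def by simp
    show "d i = 0" if "d i = d (i + 2)" for i
      using c(3) mn[of i] that unfolding d2 unfolding proper_def d_def by simp
    show "distinct [0, d (a - 1), d a, d (b - 1), d b]" if ab: "chord a b" for a b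
    proof -
      have r: "1 \<le> a" "a \<le> n" "b \<le> n" using ab unfolding chord_def by auto
      have "distinct [0, c (a - 1), c a, c (b - 1), c b]"
      proof (cases "a = 1")
        case True
        then show ?thesis using one[of b] ab by simp
      next
        case False
        then show ?thesis using proper_chord[OF c(3) ab] r by simp
      qed
      then show ?thesis using r by (simp add: dc)
    qed
  qed
qed

lemma ex_packing:
  assumes "theta_free E" and "(\<exists>k. chord 1 k) \<or> (\<forall>a b. \<not> chord a b)"
  shows "\<exists>C. packing_edge_coloring [1, 2, 2, 2, 2] E C"
proof (cases "n = 4")
  case True \<comment> \<open>the chords of $K_4$ may cross, as $K_4$ is theta-free\<close>
  show ?thesis
  \<comment> \<open>Each of the four cycle edges gets a colour of its own, so crossing chords do no
    harm.\<close>
  proof (rule packing_of_cyclic_coloring[of "\<lambda>i. i mod 4 + 1"])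
    show "i mod 4 + 1 = j mod 4 + 1" if "i mod n = j mod n" for i j using that True by simp
    show "i mod 4 + 1 \<le> 4" for i :: nat by (simp add: Suc_le_eq)
    show "i mod 4 + 1 \<noteq> (i + 1) mod 4 + 1" for i :: nat by presburger
    show "i mod 4 + 1 = 0" if "i mod 4 + 1 = (i + 2) mod 4 + 1" for i :: nat using that by presburger
    show "distinct [0, (a - 1) mod 4 + 1, a mod 4 + 1, (b - 1) mod 4 + 1, b mod 4 + 1]" if "chord a b" for a b
    proof -
      have "a = 1 \<and> b = 3 \<or> a = 2 \<and> b = 4" using that True unfolding chord_def by auto
      then show ?thesis by auto
    qed
  qed
next
  case False
  have nc: "noncrossing_chords chord" by (rule noncrossing_chords_chord[OF assms(1) False])
  interpret noncrossing_chords chord by (rule nc)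
  show ?thesis
  proof (cases "\<exists>k. chord 1 k")
    case True
    then obtain k where k: "chord 1 k" by blast
    then have "k < n" unfolding chord_def by auto
    then obtain c where c: "c 0 = c n" "c (n + 1) = c 1" "proper c 0 (n + 1)"
        "distinct [0, c 0, c 1, c (k - 1), c k]"
      using ex_cyclic_coloring_chord[OF k, of n] unfolding chord_def by blast
    have "k' = k" if "chord 1 k'" for k' using chord_unique[OF k that] by simp
    then show ?thesis using packing_of_cyclic_proper[OF nc c(1,2,3)] c(4) by blast
  next
    case no: False
    then have "\<not> chord a b" for a b using assms(2) by blast
    then show ?thesis
      using ex_cyclic_coloring_no_chord[OF n3] packing_of_cyclic_proper[OF nc] by metis
  qed
qed

end

section \<open>Numbering and rotating the cycle\<close>

lemma hamiltonian_graph_of_cycle: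
  assumes g: "simple_graph V E" "subcubic V E" and xs: "cycle E xs" "set xs = V" "3 \<le> length xs"
  shows "hamiltonian_graph V E (length xs) (\<lambda>i. xs ! (i mod length xs))"
proof
  let ?n = "length xs"
  have mn: "i mod ?n < ?n" for i using xs(3) by (intro mod_less_divisor) linarith
  have d: "distinct xs" and w: "walk E (last xs # xs)" using xs(1) unfolding cycle_def by auto
  show "simple_graph V E" "subcubic V E" "3 \<le> ?n" by fact+
  show "xs ! (i mod ?n) = xs ! (j mod ?n) \<longleftrightarrow> i mod ?n = j mod ?n" for i j
    using d mn by (simp add: nth_eq_iff_index_eq)
  show "range (\<lambda>i. xs ! (i mod ?n)) = V"
  proof
    show "range (\<lambda>i. xs ! (i mod ?n)) \<subseteq> V" using xs(2) mn by auto
    show "V \<subseteq> range (\<lambda>i. xs ! (i mod ?n))"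
    proof
      fix x assume "x \<in> V"
      then obtain i where "i < ?n" "xs ! i = x" using xs(2) by (auto simp: in_set_conv_nth)
      then show "x \<in> range (\<lambda>i. xs ! (i mod ?n))" by (intro range_eqI[of _ _ i]) simp
    qed
  qed
  show "{xs ! (i mod ?n), xs ! ((i + 1) mod ?n)} \<in> E" for i
  proof (cases "i mod ?n + 1 = ?n")
    case True
    then have z: "(i + 1) mod ?n = 0" by (metis mod_add_left_eq mod_self)
    have "i mod ?n = ?n - 1" using True by simp
    moreover have "xs \<noteq> []" using xs(3) by auto
    moreover have "{last xs, hd xs} \<in> E" using w \<open>xs \<noteq> []\<close> by (simp add: successively_Cons)
    ultimately show ?thesis unfolding z by (simp add: last_conv_nth hd_conv_nth)
  next
    case False
    then have lt: "i mod ?n + 1 < ?n" using mn[of i] by simp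
    then have "(i + 1) mod ?n = i mod ?n + 1" by (metis mod_add_left_eq mod_less)
    moreover have "walk E xs" using w xs(3) by (auto simp: successively_Cons)
    ultimately show ?thesis using lt by (simp add: successively_conv_nth)
  qed
qed

lemma (in hamiltonian_graph) hamiltonian_graph_shift: "hamiltonian_graph V E n (\<lambda>i. v (i + r))"
proof
  show "v (i + r) = v (j + r) \<longleftrightarrow> i mod n = j mod n" for i j
  proof (induction i j rule: linorder_wlog)
    case (le i j)
    then have "j + r = i + r + (j - i)" "j = i + (j - i)" by simp_all
    then show ?case using v_eq_add[of "i + r" "j - i"] v_eq_add[of i "j - i"] v_eq[of i j] by metis
  qed metis
  show "range (\<lambda>i. v (i + r)) = V"
  proof
    show "V \<subseteq> range (\<lambda>i. v (i + r))"
    proof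
      fix x assume "x \<in> V"
      then obtain i where i: "v i = x" using range_v by blast
      \<comment> \<open>Adding \<open>r * (n - 1)\<close> undoes the shift by \<open>r\<close>
        modulo \<open>n\<close>.\<close>
      have "i + r * (n - 1) + r = i + r * n" using n3 by (cases n) auto
      then have "v (i + r * (n - 1) + r) = x" using i v_eq[of "i + r * n" i] by (metis mod_mult_self1)
      then show "x \<in> range (\<lambda>i. v (i + r))" by blast
    qed
  qed (use range_v in blast)
  show "{v (i + r), v (i + 1 + r)} \<in> E" for i using step[of "i + r"] by simp
qed (fact graph cubic n3)+

theorem theorem2p1:
  fixes V :: "'a set" and E :: "'a set set"
  assumes "simple_graph V E"
    and "k_connected 2 V E"
    and "subcubic V E"
    and "outerplanar V E"
  shows "\<exists>C. packing_edge_coloring [1, 2, 2, 2, 2] E C"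
proof -
  have th: "theta_free E" using outerplanar_imp_theta_free assms(1,4) .
  obtain xs where xs: "cycle E xs" "set xs = V" using ex_hamiltonian_cycle[OF assms(1,2) th] by blast
  define n where "n = length xs"
  have "n = card V" using xs unfolding n_def cycle_def by (simp add: distinct_card[symmetric])
  \<comment> \<open>This discards the degenerate cycle of length 2.\<close>
  then have "3 \<le> n" using assms(2) unfolding k_connected_def by simp
  then obtain v where v: "hamiltonian_graph V E n v"
    using hamiltonian_graph_of_cycle[OF assms(1,3) xs] unfolding n_def by blast
  interpret v: hamiltonian_graph V E n v by (rule v)
  show ?thesis
  proof (cases "\<exists>a b. v.chord a b")
    case True
    then obtain a b where ab: "v.chord a b" by blast
    \<comment> \<open>Rotating by \<open>a - 1\<close> modulo \<open>n\<close> makes the chord begin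
      at index 1, as \<open>ex_packing\<close> requires.\<close>
    define u where "u i = v (i + (a + n - 1))" for i
    interpret u: hamiltonian_graph V E n u
      unfolding u_def by (rule v.hamiltonian_graph_shift)
    have r: "1 \<le> a" "a + 2 \<le> b" "b \<le> n" "\<not> (a = 1 \<and> b = n)" "{v a, v b} \<in> E"
      using ab unfolding v.chord_def by auto
    have "1 + (a + n - 1) = a + n" "b - a + 1 + (a + n - 1) = b + n" using r by linarith+
    then have "u 1 = v a" "u (b - a + 1) = v b" unfolding u_def using v.v_add_n by metis+
    then have "u.chord 1 (b - a + 1)" using r unfolding u.chord_def by auto
    then show ?thesis using u.ex_packing[OF th] by blast
  next
    case False
    then show ?thesis using v.ex_packing[OF th] by blast
  qed
qed

end
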